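(* Let $d\geq 3$ and let $\mathcal{F}=V(x^d+y^d+z^d)\subset\mathbb{P}^2$ be the Fermat curve of degree $d$ over $\mathbb{C}$. Let $$\mathcal{M}=V\left((z^d+2y^d)(x^d+2z^d)(y^d+2x^d)\right),\qquad \mathcal{N}=V\left((y^d+2z^d)(z^d+2x^d)(x^d+2y^d)\right),$$ each a union of $3d$ lines. Let $L$ be any line in $\mathcal{M}$ (or in $\mathcal{N}$), and consider the $d$ sextactic points of $\mathcal{F}$ lying on $L$. Then the $d$ hyperosculating conics to $\mathcal{F}$ at these points have two common intersection points (that is, the set of points lying on all $d$ conics has two elements).
   Context: The osculating conic $O_p$ to $\mathcal{F}$ at $p$ is the unique conic with intersection multiplicity $(O_p.\mathcal{F})_p\geq 5$; it is hyperosculating if $(O_p.\mathcal{F})_p\geq 6$. An inflection point is a point $p$ whose tangent line meets $\mathcal{F}$ at $p$ with multiplicity at least $3$. A sextactic point is a point of $\mathcal{F}$ that is not an inflection point and at which the osculating conic is hyperosculating. Each line in $\mathcal{M}$ and each line in $\mathcal{N}$ contains exactly $d$ sextactic points of $\mathcal{F}$. *)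

theory Defs
  imports
    "HOL-Analysis.Analysis"
    "HOL-Library.Poly_Mapping"
    "HOL-Library.Extended_Nat"
    "HOL-Computational_Algebra.Fraction_Field"
begin

text \<open>
  \<^typ>\<open>3\<close> is the three-element numeral type (with elements 1, 2 and 3 = 0); it indexes
  the coordinates of \<^typ>\<open>complex^3\<close> and the three indeterminates, so that
  \<open>poly3\<close> is the ring C[x,y,z].
\<close>

type_synonym poly3 = "(3 \<Rightarrow>\<^sub>0 nat) \<Rightarrow>\<^sub>0 complex"

definition const3 :: "complex \<Rightarrow> poly3" where
  "const3 c = Poly_Mapping.single 0 c"

definition var3 :: "3 \<Rightarrow> poly3" where
  "var3 i = Poly_Mapping.single (Poly_Mapping.single i 1) 1"

definition eval3 :: "poly3 \<Rightarrow> complex^3 \<Rightarrow> complex" where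
  "eval3 f v = (\<Sum>m\<in>Poly_Mapping.keys f.
     Poly_Mapping.lookup f m * (\<Prod>i\<in>UNIV. (v $ i) ^ Poly_Mapping.lookup m i))"

definition pderiv3 :: "3 \<Rightarrow> poly3 \<Rightarrow> poly3" where
  "pderiv3 i f = (\<Sum>m\<in>Poly_Mapping.keys f.
     Poly_Mapping.single (m - Poly_Mapping.single i 1)
       (of_nat (Poly_Mapping.lookup m i) * Poly_Mapping.lookup f m))"

definition homogeneous3 :: "nat \<Rightarrow> poly3 \<Rightarrow> bool" where
  "homogeneous3 n f \<longleftrightarrow>
     (\<forall>m\<in>Poly_Mapping.keys f. (\<Sum>i\<in>UNIV. Poly_Mapping.lookup m i) = n)"


text \<open>A point of the projective plane is a one-dimensional linear subspace of C^3.\<close>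

definition P2 :: "(complex^3) set set" where
  "P2 = {vec.span {v} | v. v \<noteq> 0}"

definition V :: "poly3 \<Rightarrow> (complex^3) set set" where
  "V f = {p \<in> P2. \<forall>v\<in>p. eval3 f v = 0}"

definition projective_line :: "(complex^3) set set \<Rightarrow> bool" where
  "projective_line L \<longleftrightarrow> (\<exists>l. homogeneous3 1 l \<and> l \<noteq> 0 \<and> L = V l)"


text \<open>
  The local ring of the plane at \<open>p\<close>, inside the field of fractions of C[x,y,z]: the
  quotients of two forms of equal degree whose denominator does not vanish at \<open>p\<close>.
\<close>

definition local_ring :: "(complex^3) set \<Rightarrow> poly3 fract set" where
  "local_ring p = {Fract a b | a b.
     (\<exists>n. homogeneous3 n a \<and> homogeneous3 n b) \<and> p \<notin> V b}"

text \<open>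
  The ideal of \<^term>\<open>local_ring p\<close> generated by two forms \<open>f\<close> and \<open>g\<close>, i.e. the
  degree-zero part of the localization at \<open>p\<close> of the homogeneous ideal (f,g).
\<close>

definition local_ideal ::
    "(complex^3) set \<Rightarrow> poly3 \<Rightarrow> poly3 \<Rightarrow> poly3 fract set" where
  "local_ideal p f g = {Fract (r * f + s * g) b | r s b.
     (\<exists>n. homogeneous3 n (r * f + s * g) \<and> homogeneous3 n b) \<and> p \<notin> V b}"

text \<open>
  The dimension over C of the quotient space \<open>A / W\<close>, as the supremum of the sizes of
  finite families in \<open>A\<close> that are linearly independent modulo \<open>W\<close>.
\<close>

definition quotient_dim :: "poly3 fract set \<Rightarrow> poly3 fract set \<Rightarrow> enat" where
  "quotient_dim A W = Sup {enat (card B) | B. finite B \<and> B \<subseteq> A \<and>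
     (\<forall>c. (\<Sum>b\<in>B. Fract (const3 (c b)) 1 * b) \<in> W \<longrightarrow> (\<forall>b\<in>B. c b = 0))}"

definition intersection_mult :: "(complex^3) set \<Rightarrow> poly3 \<Rightarrow> poly3 \<Rightarrow> enat" where
  "intersection_mult p f g = quotient_dim (local_ring p) (local_ideal p f g)"


definition tangent_form :: "poly3 \<Rightarrow> complex^3 \<Rightarrow> poly3" where
  "tangent_form F v = (\<Sum>i\<in>UNIV. const3 (eval3 (pderiv3 i F) v) * var3 i)"

text \<open>
  The choice of the representative \<open>v\<close> of \<open>p\<close> only rescales the tangent form.
\<close>

definition inflection_point :: "poly3 \<Rightarrow> (complex^3) set \<Rightarrow> bool" where
  "inflection_point F p \<longleftrightarrow> p \<in> V F \<and>
     (\<exists>v\<in>p. v \<noteq> 0 \<and> intersection_mult p (tangent_form F v) F \<ge> 3)"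

text \<open>
  Conics may be reducible or non-reduced; two forms define the same conic iff they are
  proportional.
\<close>

definition conic :: "poly3 \<Rightarrow> bool" where
  "conic Q \<longleftrightarrow> homogeneous3 2 Q \<and> Q \<noteq> 0"

definition osculating_conic :: "poly3 \<Rightarrow> (complex^3) set \<Rightarrow> poly3 \<Rightarrow> bool" where
  "osculating_conic F p Q \<longleftrightarrow> conic Q \<and> intersection_mult p Q F \<ge> 5 \<and>
     (\<forall>Q'. conic Q' \<and> intersection_mult p Q' F \<ge> 5 \<longrightarrow> (\<exists>c. Q' = const3 c * Q))"

definition hyperosculating_conic :: "poly3 \<Rightarrow> (complex^3) set \<Rightarrow> poly3 \<Rightarrow> bool" where
  "hyperosculating_conic F p Q \<longleftrightarrow> osculating_conic F p Q \<and> intersection_mult p Q F \<ge> 6"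

definition sextactic_point :: "poly3 \<Rightarrow> (complex^3) set \<Rightarrow> bool" where
  "sextactic_point F p \<longleftrightarrow>
     p \<in> V F \<and> \<not> inflection_point F p \<and> (\<exists>Q. hyperosculating_conic F p Q)"


abbreviation "X \<equiv> var3 1"
abbreviation "Y \<equiv> var3 2"
abbreviation "Z \<equiv> var3 3"

definition fermat :: "nat \<Rightarrow> poly3" where
  "fermat d = X ^ d + Y ^ d + Z ^ d"

definition arrangement_M :: "nat \<Rightarrow> poly3" where
  "arrangement_M d = (Z ^ d + 2 * Y ^ d) * (X ^ d + 2 * Z ^ d) * (Y ^ d + 2 * X ^ d)"

definition arrangement_N :: "nat \<Rightarrow> poly3" where
  "arrangement_N d = (Y ^ d + 2 * Z ^ d) * (Z ^ d + 2 * X ^ d) * (X ^ d + 2 * Y ^ d)"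

end

theory Submission
  imports Defs
begin

text \<open>
  Every line of the two arrangements has the form \<open>x\<^sub>j = \<beta> x\<^sub>k\<close> with \<open>\<beta>\<^sup>d = -1/2\<close>, and it meets the
  Fermat curve in the \<open>d\<close> points \<open>(\<alpha> : \<beta> : 1)\<close> with \<open>\<alpha>\<^sup>d = -1/2\<close>. In the coordinates \<open>x = x\<^sub>i/\<alpha>\<close>,
  \<open>y = x\<^sub>j/\<beta>\<close>, \<open>w = x\<^sub>k\<close> the curve is \<open>x\<^sup>d + y\<^sup>d = 2 w\<^sup>d\<close> and the point is \<open>(1 : 1 : 1)\<close>. The swap of \<open>x\<close>
  and \<open>y\<close> forces the osculating conic to be symmetric, hence to have even contact; it is therefore
  hyperosculating, with equation
  \<open>d(d+1)(x\<^sup>2 + y\<^sup>2) - 2(5d-3)(d-2) x y + 8d(d-2) w (x + y) - 4(2d-3)(d+1) w\<^sup>2 = 0\<close>.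
  At a point on all \<open>d \<ge> 3\<close> conics the left-hand side is a polynomial of degree two in \<open>1/\<alpha>\<close> with at least three
  roots, so \<open>x\<^sub>i = 0\<close>, and the remaining binary quadratic form in \<open>y\<close> and \<open>w\<close> has
  nonzero discriminant \<open>48 d (d-1)\<^sup>2 (2d-1)\<close>.

  Intersection multiplicities at a smooth point are computed as orders of vanishing along a truncated
  parametrization of the curve.
\<close>

section \<open>Polynomials as sums of monomials, and homogeneity\<close>

lemma poly3_eq_sum: "f = (\<Sum>m\<in>Poly_Mapping.keys f. Poly_Mapping.single m (Poly_Mapping.lookup f m))"
  for f :: poly3
proof (rule poly_mapping_eqI)
  fix k
  show "Poly_Mapping.lookup f k =
      Poly_Mapping.lookup (\<Sum>m\<in>Poly_Mapping.keys f. Poly_Mapping.single m (Poly_Mapping.lookup f m)) k"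
    by (cases "k \<in> Poly_Mapping.keys f")
      (simp_all add: lookup_sum lookup_single when_def in_keys_iff)
qed

text \<open>Every exponent in a form of degree \<open>n\<close> has total degree \<open>n\<close>,
  so an additive property need only be checked on monomials of that degree.\<close>

lemma homogeneous3_induct [consumes 1, case_names zero single add]:
  assumes "homogeneous3 n f"
    and "P 0"
    and "\<And>m c. (\<Sum>i\<in>UNIV. Poly_Mapping.lookup m i) = n \<Longrightarrow> P (Poly_Mapping.single m c)"
    and "\<And>f g. P f \<Longrightarrow> P g \<Longrightarrow> P (f + g)"
  shows "P f"
proof -
  have "P (\<Sum>m\<in>M. Poly_Mapping.single m (Poly_Mapping.lookup f m))"
    if "finite M" "M \<subseteq> Poly_Mapping.keys f" for M
    using that assms by (induction M rule: finite_induct) (auto simp: homogeneous3_def)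
  then show ?thesis
    by (metis finite_keys order_refl poly3_eq_sum)
qed

lemma poly3_induct [case_names zero single add]:
  fixes f :: poly3
  assumes "P 0" "\<And>m c. P (Poly_Mapping.single m c)" "\<And>f g. P f \<Longrightarrow> P g \<Longrightarrow> P (f + g)"
  shows "P f"
proof -
  have "P (\<Sum>m\<in>M. Poly_Mapping.single m (Poly_Mapping.lookup f m))" if "finite M" for M
    using that assms by (induction M rule: finite_induct) auto
  then show ?thesis
    by (metis finite_keys poly3_eq_sum)
qed

lemma homogeneous3_zero [simp]: "homogeneous3 n 0"
  by (simp add: homogeneous3_def)

lemma homogeneous3_add: "homogeneous3 n f \<Longrightarrow> homogeneous3 n g \<Longrightarrow> homogeneous3 n (f + g)"
  using keys_add[of f g] by (auto simp: homogeneous3_def)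

lemma homogeneous3_mult:
  assumes "homogeneous3 n f" "homogeneous3 m g"
  shows "homogeneous3 (n + m) (f * g)"
  unfolding homogeneous3_def
proof
  fix k assume "k \<in> Poly_Mapping.keys (f * g)"
  then obtain a b where "k = a + b" "a \<in> Poly_Mapping.keys f" "b \<in> Poly_Mapping.keys g"
    using keys_mult[of f g] by blast
  with assms show "(\<Sum>i\<in>UNIV. Poly_Mapping.lookup k i) = n + m"
    by (simp add: homogeneous3_def lookup_add sum.distrib)
qed

lemma homogeneous3_const [simp]: "homogeneous3 0 (const3 c)"
  by (auto simp: homogeneous3_def const3_def)

lemma homogeneous3_one [simp]: "homogeneous3 0 1"
  by (auto simp: homogeneous3_def)

lemma homogeneous3_var [simp]: "homogeneous3 (Suc 0) (var3 i)"
  by (auto simp: homogeneous3_def var3_def lookup_single when_def)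

lemma homogeneous3_power: "homogeneous3 n f \<Longrightarrow> homogeneous3 (k * n) (f ^ k)"
  by (induction k) (auto intro: homogeneous3_mult)

lemma homogeneous3_const_mult: "homogeneous3 n f \<Longrightarrow> homogeneous3 n (const3 c * f)"
  using homogeneous3_mult[OF homogeneous3_const] by fastforce

lemma homogeneous3_sum: "(\<And>i. i \<in> A \<Longrightarrow> homogeneous3 n (f i)) \<Longrightarrow> homogeneous3 n (sum f A)"
  by (induction A rule: infinite_finite_induct) (auto intro: homogeneous3_add)

lemma const3_0 [simp]: "const3 0 = 0"
  by (simp add: const3_def)

lemma const3_1 [simp]: "const3 1 = 1"
  by (simp add: const3_def)

lemma const3_add: "const3 (a + b) = const3 a + const3 b"
  by (simp add: const3_def single_add)

lemma const3_mult: "const3 (a * b) = const3 a * const3 b"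
  by (simp add: const3_def mult_single)

lemma const3_uminus: "const3 (- a) = - const3 a"
  by (simp add: const3_def single_uminus)

lemma var3_power: "var3 i ^ n = Poly_Mapping.single (Poly_Mapping.single i n) 1"
  by (induction n) (auto simp: var3_def mult_single single_add[symmetric])

section \<open>Substitution homomorphisms out of C[x,y,z]\<close>

definition subst3 :: "(complex \<Rightarrow> 'a::comm_ring_1) \<Rightarrow> (3 \<Rightarrow> 'a) \<Rightarrow> poly3 \<Rightarrow> 'a" where
  "subst3 h x f = (\<Sum>m\<in>Poly_Mapping.keys f.
     h (Poly_Mapping.lookup f m) * (\<Prod>i\<in>UNIV. x i ^ Poly_Mapping.lookup m i))"

lemma eval3_eq_subst3: "eval3 f v = subst3 (\<lambda>c. c) (($) v) f"
  by (simp add: eval3_def subst3_def)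

text \<open>A homomorphism on the constants and a choice of images of the variables determine a ring
  homomorphism. Three instances are used: evaluation at a vector, substitution of a power series
  parametrization, and passage to affine coordinates in the fraction field.\<close>

locale coeff_hom =
  fixes h :: "complex \<Rightarrow> 'a::comm_ring_1"
  assumes hom_add: "h (a + b) = h a + h b"
    and hom_mult: "h (a * b) = h a * h b"
    and hom_one: "h 1 = 1"
begin

lemma hom_zero: "h 0 = 0"
  using hom_add[of 0 0] by simp

text \<open>Cancellation can make the support of a sum smaller than the union of the supports.
  Summing over a common larger set makes the two sides of \<open>subst3_add\<close>
  comparable.\<close>

lemma subst3_superset:
  assumes "finite S" "Poly_Mapping.keys f \<subseteq> S"
  shows "subst3 h x f = (\<Sum>m\<in>S. h (Poly_Mapping.lookup f m) * (\<Prod>i\<in>UNIV. x i ^ Poly_Mapping.lookup m i))"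
  unfolding subst3_def using assms
  by (intro sum.mono_neutral_left) (auto simp: in_keys_iff hom_zero)

lemma subst3_zero [simp]: "subst3 h x 0 = 0"
  by (simp add: subst3_def)

lemma subst3_single:
  "subst3 h x (Poly_Mapping.single m c) = h c * (\<Prod>i\<in>UNIV. x i ^ Poly_Mapping.lookup m i)"
  by (simp add: subst3_def hom_zero)

lemma subst3_add: "subst3 h x (f + g) = subst3 h x f + subst3 h x g"
  using keys_add[of f g]
  by (simp add: subst3_superset[of "Poly_Mapping.keys f \<union> Poly_Mapping.keys g"]
      lookup_add hom_add algebra_simps sum.distrib)

lemma subst3_mult: "subst3 h x (f * g) = subst3 h x f * subst3 h x g"
proof (induction f rule: poly3_induct)
  case (single m c)
  show ?case
  proof (induction g rule: poly3_induct)
    case (single n e)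
    show ?case
      by (simp add: mult_single subst3_single hom_mult lookup_add power_add prod.distrib)
  qed (simp_all add: distrib_left subst3_add)
qed (simp_all add: distrib_right subst3_add)

lemma subst3_const: "subst3 h x (const3 c) = h c"
  by (simp add: const3_def subst3_single)

lemma subst3_one: "subst3 h x 1 = 1"
  using subst3_const[of x 1] by (simp add: hom_one)

lemma subst3_var: "subst3 h x (var3 i) = x i"
proof -
  have "x j ^ Poly_Mapping.lookup (Poly_Mapping.single i 1) j = (if j = i then x i else 1)" for j
    by (simp add: lookup_single)
  then show ?thesis
    by (simp add: var3_def subst3_single hom_one)
qed

lemma subst3_power: "subst3 h x (f ^ n) = subst3 h x f ^ n"
  by (induction n) (simp_all add: subst3_one subst3_mult)

lemma subst3_sum: "subst3 h x (sum f A) = (\<Sum>a\<in>A. subst3 h x (f a))"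
  by (induction A rule: infinite_finite_induct) (simp_all add: subst3_add)

lemmas subst3_simps = subst3_add subst3_mult subst3_const subst3_one subst3_var subst3_power subst3_sum

lemma subst3_homogeneous:
  assumes "homogeneous3 n f"
  shows "subst3 h (\<lambda>i. c * x i) f = c ^ n * subst3 h x f"
  using assms
  by (induction rule: homogeneous3_induct)
    (simp_all add: subst3_single subst3_add power_mult_distrib prod.distrib algebra_simps
      flip: power_sum)

end

interpretation eval: coeff_hom "\<lambda>c. c"
  by unfold_locales auto

interpretation fps_subst: coeff_hom fps_const
  by unfold_locales auto

abbreviation const_fract :: "complex \<Rightarrow> poly3 fract" where
  "const_fract c \<equiv> Fract (const3 c) 1"

interpretation fract_subst: coeff_hom const_fract
  by unfold_locales (simp_all add: const3_add const3_mult One_fract_def)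

lemma eval3_simps:
  "eval3 (f + g) v = eval3 f v + eval3 g v"
  "eval3 (f * g) v = eval3 f v * eval3 g v"
  "eval3 (const3 c) v = c"
  "eval3 1 v = 1"
  "eval3 (var3 i) v = v $ i"
  "eval3 (f ^ n) v = eval3 f v ^ n"
  "eval3 (sum F A) v = (\<Sum>a\<in>A. eval3 (F a) v)"
  "eval3 0 v = 0"
  by (simp_all add: eval3_eq_subst3 eval.subst3_simps)

lemma eval3_numeral [simp]: "eval3 (numeral k) v = numeral k"
proof -
  have "numeral k = const3 (numeral k)" 
    by (simp add: const3_def)
  then show ?thesis
    by (metis eval3_simps(3))
qed

lemma eval3_scale: "homogeneous3 n f \<Longrightarrow> eval3 f (c *s v) = c ^ n * eval3 f v"
  using eval.subst3_homogeneous[of n f c "($) v"]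
  by (simp add: eval3_eq_subst3 vector_scalar_mult_def cong: if_cong)
    (metis (no_types, lifting) ext vec_lambda_beta)

text \<open>Taking the constant coefficient is a ring homomorphism, so it commutes with
  substitution. This ties a parametrization to the values of polynomials at its centre.\<close>

lemma fps_nth_0_subst3: "fps_nth (subst3 fps_const g f) 0 = subst3 (\<lambda>c. c) (\<lambda>i. fps_nth (g i) 0) f"
proof (induction f rule: poly3_induct)
  case (single m c)
  have "fps_nth (\<Prod>i\<in>A. g i ^ Poly_Mapping.lookup m i) 0 = (\<Prod>i\<in>A. fps_nth (g i) 0 ^ Poly_Mapping.lookup m i)" for A
    by (induction A rule: infinite_finite_induct) (simp_all add: fps_power_zeroth)
  then show ?case
    by (simp add: fps_subst.subst3_single eval.subst3_single)
qed (simp_all add: fps_subst.subst3_add eval.subst3_add)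

lemma Fract_eq_subst3: "Fract f 1 = subst3 const_fract (\<lambda>i. Fract (var3 i) 1) f"
proof (induction f rule: poly3_induct)
  case (single m c)
  have *: "(Fract a 1) ^ n = Fract (a ^ n) 1" for a :: poly3 and n
    by (induction n) (simp_all add: One_fract_def)
  have **: "(\<Prod>i\<in>A. Fract (g i) 1) = Fract (\<Prod>i\<in>A. g i) 1" for A and g :: "3 \<Rightarrow> poly3"
    by (induction A rule: infinite_finite_induct) (simp_all add: One_fract_def)
  have ***: "(\<Prod>i\<in>A. Poly_Mapping.single (k i) 1) = (Poly_Mapping.single (\<Sum>i\<in>A. k i) 1 :: poly3)" for A k
    by (induction A rule: infinite_finite_induct) (simp_all add: mult_single)
  have "(\<Sum>i\<in>UNIV. Poly_Mapping.single i (Poly_Mapping.lookup m i)) = m"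
    by (rule poly_mapping_eqI) (simp add: lookup_sum lookup_single when_def)
  then show ?case
    unfolding fract_subst.subst3_single
    by (simp add: * ** *** var3_power const3_def mult_single)
next
  case (add f g)
  then show ?case
    by (simp add: fract_subst.subst3_add flip: add)
qed (simp add: Zero_fract_def)

text \<open>Dehomogenization: writing \<open>x_i = x_k (x_i / x_k)\<close> takes \<open>n\<close>
  factors \<open>x_k\<close> out of a form of degree \<open>n\<close>.\<close>

lemma Fract_homogeneous:
  assumes "homogeneous3 n f"
  shows "Fract f (var3 k ^ n) = subst3 const_fract (\<lambda>i. Fract (var3 i) (var3 k)) f"
proof -
  have nz: "var3 k \<noteq> 0"
    by (simp add: var3_def) (metis single_zero inj_single injD zero_neq_one)
  have "Fract f 1 = subst3 const_fract (\<lambda>i. Fract (var3 k) 1 * Fract (var3 i) (var3 k)) f"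
  proof -
    have "Fract (var3 k) 1 * Fract (var3 i) (var3 k) = Fract (var3 i) 1" for i
      using nz by (simp add: eq_fract)
    then show ?thesis
      by (simp only: Fract_eq_subst3[of f])
  qed
  also have "\<dots> = Fract (var3 k) 1 ^ n * subst3 const_fract (\<lambda>i. Fract (var3 i) (var3 k)) f"
    using assms by (rule fract_subst.subst3_homogeneous)
  also have "Fract (var3 k) 1 ^ n = Fract (var3 k ^ n) 1"
    by (induction n) (simp_all add: One_fract_def)
  finally have "Fract 1 (var3 k ^ n) * Fract f 1
      = (Fract 1 (var3 k ^ n) * Fract (var3 k ^ n) 1) * subst3 const_fract (\<lambda>i. Fract (var3 i) (var3 k)) f"
    by (simp only: mult.assoc)
  also have "Fract 1 (var3 k ^ n) * Fract (var3 k ^ n) 1 = 1"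
    using nz by (simp add: One_fract_def eq_fract)
  finally show ?thesis
    by simp
qed

lemma var3_neq_0 [simp]: "var3 i \<noteq> 0"
  by (simp add: var3_def) (metis single_zero inj_single injD zero_neq_one)

section \<open>Points of the plane and zero sets of forms\<close>

lemma span_in_P2: "v \<noteq> 0 \<Longrightarrow> vec.span {v} \<in> P2"
  by (auto simp: P2_def)

text \<open>\<open>V\<close> tests all vectors of the subspace; rescaling multiplies the value of a
  form by a power of the scalar, so one representative decides.\<close>

lemma span_in_V_iff:
  assumes "homogeneous3 n f" "v \<noteq> 0"
  shows "vec.span {v} \<in> V f \<longleftrightarrow> eval3 f v = 0"
proof
  assume "vec.span {v} \<in> V f"
  then show "eval3 f v = 0"
    by (auto simp: V_def intro: vec.span_base)
next
  assume "eval3 f v = 0"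
  with assms show "vec.span {v} \<in> V f"
    using span_in_P2[OF \<open>v \<noteq> 0\<close>] by (auto simp: V_def vec.span_singleton eval3_scale)
qed

lemma homogeneous3_fermat: "homogeneous3 d (fermat d)"
  unfolding fermat_def using homogeneous3_power[OF homogeneous3_var, of d]
  by (auto intro!: homogeneous3_add)

section \<open>Orders of power series, and a dimension count\<close>

definition fps_ord_ge :: "nat \<Rightarrow> 'a::comm_ring_1 fps \<Rightarrow> bool" where
  "fps_ord_ge n f \<longleftrightarrow> (\<forall>m<n. fps_nth f m = 0)"

lemma fps_ord_ge_add: "fps_ord_ge n f \<Longrightarrow> fps_ord_ge n g \<Longrightarrow> fps_ord_ge n (f + g)"
  by (simp add: fps_ord_ge_def)

lemma fps_ord_ge_mult: "fps_ord_ge n f \<Longrightarrow> fps_ord_ge n (f * g)"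
  by (simp add: fps_ord_ge_def fps_mult_nth)

lemma fps_ord_ge_mult_unit:
  fixes f u :: "'a::field fps"
  assumes "fps_ord_ge n (f * u)" "fps_nth u 0 \<noteq> 0"
  shows "fps_ord_ge n f"
proof -
  have "(f * u) * inverse u = f"
    by (simp only: mult.assoc inverse_mult_eq_1'[OF assms(2)] mult_1_right)
  then show ?thesis
    using fps_ord_ge_mult[OF assms(1), of "inverse u"] by metis
qed

text \<open>\<open>h^n\<close> starts in degree \<open>n\<close> with coefficient
  \<open>h_1^n\<close>, so a single term of the convolution survives.\<close>

lemma fps_nth_mult_power:
  fixes h f :: "'a::comm_ring_1 fps"
  assumes "fps_nth h 0 = 0"
  shows "fps_nth (h ^ n * f) n = fps_nth h 1 ^ n * fps_nth f 0"
proof -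
  have "fps_nth (h ^ n * f) n = (\<Sum>i\<in>{0..n}. fps_nth (h ^ n) i * fps_nth f (n - i))"
    by (simp add: fps_mult_nth)
  also have "\<dots> = (\<Sum>i\<in>{n}. fps_nth (h ^ n) i * fps_nth f (n - i))"
    using startsby_zero_power_prefix[OF assms]
    by (intro sum.mono_neutral_right) auto
  also have "\<dots> = fps_nth h 1 ^ n * fps_nth f 0"
    using startsby_zero_power_nth_same[OF assms] by simp
  finally show ?thesis .
qed

text \<open>The system is triangular: \<open>h^l\<close> starts in degree \<open>l\<close> with
  nonzero leading coefficient, so the \<open>c m\<close> vanish one after another.\<close>

lemma power_series_independent:
  fixes h :: "'a::idom fps"
  assumes h: "fps_nth h 0 = 0" "fps_nth h 1 \<noteq> 0"
    and ord: "fps_ord_ge n (\<Sum>m<n. fps_const (c m) * h ^ m)"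
    and "m < n"
  shows "c m = 0"
  using \<open>m < n\<close>
proof (induction m rule: less_induct)
  case (less m)
  have "0 = fps_nth (\<Sum>l<n. fps_const (c l) * h ^ l) m"
    using ord less.prems by (simp add: fps_ord_ge_def)
  also have "\<dots> = (\<Sum>l<n. c l * fps_nth (h ^ l) m)"
    by (simp add: fps_sum_nth)
  \<comment> \<open>Terms with \<open>l < m\<close> vanish by induction, those with
    \<open>l > m\<close> because \<open>h^l\<close> has no coefficient in degree
    \<open>m\<close>.\<close>
  also have "\<dots> = (\<Sum>l\<in>{m}. c l * fps_nth (h ^ l) m)"
    using less startsby_zero_power_prefix[OF h(1)]
    by (intro sum.mono_neutral_right) (auto, metis linorder_neqE_nat)
  also have "\<dots> = c m * fps_nth h 1 ^ m"
    using startsby_zero_power_nth_same[OF h(1)] by simp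
  finally show ?case
    using h(2) by simp
qed

text \<open>Gaussian elimination, by induction on the number of equations; \<open>A b m\<close> is
  the coefficient of the unknown \<open>c b\<close> in equation \<open>m\<close>. It serves to bound
  \<open>quotient_dim\<close> from above.\<close>

lemma homogeneous_system_nontrivial:
  fixes A :: "'b \<Rightarrow> nat \<Rightarrow> 'a::field"
  assumes "finite B" "n < card B"
  shows "\<exists>c. (\<exists>b\<in>B. c b \<noteq> 0) \<and> (\<forall>m<n. (\<Sum>b\<in>B. c b * A b m) = 0)"
  using assms
proof (induction n arbitrary: A B)
  case 0
  then show ?case
    by (intro exI[of _ "\<lambda>_. 1"]) (auto simp: card_gt_0_iff)
next
  case (Suc n)
  show ?case
  proof (cases "\<forall>b\<in>B. A b n = 0")
    case True
    obtain c where "\<exists>b\<in>B. c b \<noteq> 0" "\<forall>m<n. (\<Sum>b\<in>B. c b * A b m) = 0"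
      using Suc.IH[of B A] Suc.prems by auto
    with True show ?thesis
      by (auto simp: less_Suc_eq intro!: exI[of _ c])
  next
    case False
    \<comment> \<open>\<open>b0\<close> is the pivot: equation \<open>n\<close> eliminates its
      unknown from the other equations.\<close>
    then obtain b0 where b0: "b0 \<in> B" "A b0 n \<noteq> 0"
      by blast
    define B' where "B' = B - {b0}"
    have B': "finite B'" "n < card B'" "b0 \<notin> B'" "B = insert b0 B'"
      using Suc.prems b0 by (auto simp: B'_def)
    obtain c where c: "\<exists>b\<in>B'. c b \<noteq> 0"
        "\<forall>m<n. (\<Sum>b\<in>B'. c b * (A b m - A b n / A b0 n * A b0 m)) = 0"
      using Suc.IH[of B' "\<lambda>b m. A b m - A b n / A b0 n * A b0 m"] B' by blast
    \<comment> \<open>The pivot unknown gets the value that makes equation \<open>n\<close> hold;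
      substituting it turns the other equations into the reduced ones.\<close>
    define c' where "c' = c(b0 := - (\<Sum>b\<in>B'. c b * A b n) / A b0 n)"
    have c'_eq: "(\<Sum>b\<in>B'. c' b * A b m) = (\<Sum>b\<in>B'. c b * A b m)" for m
      using B'(3) by (intro sum.cong) (auto simp: c'_def)
    have "(\<Sum>b\<in>B. c' b * A b m) = 0" if "m < Suc n" for m
    proof -
      have "(\<Sum>b\<in>B. c' b * A b m)
          = (\<Sum>b\<in>B'. c b * A b m) - (\<Sum>b\<in>B'. c b * A b n) / A b0 n * A b0 m"
        using B' by (simp add: c'_eq) (simp add: c'_def)
      also have "\<dots> = (\<Sum>b\<in>B'. c b * (A b m - A b n / A b0 n * A b0 m))"
        by (simp add: algebra_simps sum_subtractf sum_distrib_left sum_distrib_right sum_divide_distrib)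
      also have "\<dots> = 0"
        using c(2) that b0(2) by (cases "m = n") auto
      finally show ?thesis .
    qed
    moreover have "\<exists>b\<in>B. c' b \<noteq> 0"
      using c(1) B' by (auto simp: c'_def)
    ultimately show ?thesis
      by blast
  qed
qed

section \<open>Intersection multiplicities with the Fermat curve\<close>

text \<open>
  Only multiplicities up to 6 matter, so a parametrization of the curve modulo the sixth power of
  the parameter is enough.
\<close>

locale fermat_jet =
  fixes d :: nat and i j k :: 3 and v :: "complex^3" and g :: "3 \<Rightarrow> complex fps"
  assumes d_pos: "d > 0"
    and UNIV_ijk: "UNIV = {i, j, k}"
    and distinct_ijk: "i \<noteq> j" "i \<noteq> k" "j \<noteq> k"
    and v_k: "v $ k = 1"
    and v_j: "v $ j \<noteq> 0"
    and jet_0: "fps_nth (g a) 0 = v $ a"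
    and jet_k: "g k = 1"
    and jet_i: "fps_nth (g i) 1 \<noteq> 0"
    and jet_order: "fps_ord_ge 6 (g i ^ d + g j ^ d + 1)"
begin

abbreviation "p \<equiv> vec.span {v}"
abbreviation "F \<equiv> fermat d"
abbreviation "R \<equiv> local_ring p"
abbreviation "J \<equiv> subst3 fps_const g"

lemma v_neq_0: "v \<noteq> 0"
  using v_k by auto

lemma sum_ijk: "(\<Sum>a\<in>UNIV. f a) = f i + f j + f k" for f :: "3 \<Rightarrow> 'a::comm_monoid_add"
  using distinct_ijk by (simp add: UNIV_ijk add.assoc)

lemma fermat_ijk: "F = var3 i ^ d + var3 j ^ d + var3 k ^ d"
  using sum_ijk[of "\<lambda>a. var3 a ^ d"] by (simp add: fermat_def sum_3)

lemma J_fermat: "J F = g i ^ d + g j ^ d + 1"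
  by (simp add: fermat_ijk fps_subst.subst3_simps jet_k)

lemma J_fermat_order: "fps_ord_ge 6 (J F)"
  using jet_order by (simp add: J_fermat)

lemma J_nth_0: "fps_nth (J f) 0 = eval3 f v"
  by (simp add: fps_nth_0_subst3 jet_0 eval3_eq_subst3)

lemma p_in_V_fermat: "p \<in> V F"
proof -
  have "eval3 F v = 0"
    using J_fermat_order J_nth_0[of F] by (simp add: fps_ord_ge_def)
  then show ?thesis
    using span_in_V_iff[OF homogeneous3_fermat v_neq_0] by simp
qed

section \<open>The local ring at the point and expansions along the parametrization\<close>

lemma local_ring_def':
  "R = {Fract a b | a b. (\<exists>n. homogeneous3 n a \<and> homogeneous3 n b) \<and> eval3 b v \<noteq> 0}"
  unfolding local_ring_def using span_in_V_iff[OF _ v_neq_0] by blast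

lemma local_ideal_def':
  "local_ideal p f h = {Fract (r * f + s * h) b | r s b.
     (\<exists>n. homogeneous3 n (r * f + s * h) \<and> homogeneous3 n b) \<and> eval3 b v \<noteq> 0}"
  unfolding local_ideal_def using span_in_V_iff[OF _ v_neq_0] by blast

lemma local_ringI: "homogeneous3 n a \<Longrightarrow> homogeneous3 n b \<Longrightarrow> eval3 b v \<noteq> 0 \<Longrightarrow> Fract a b \<in> R"
  by (auto simp: local_ring_def')

lemma eval3_neq_0: "eval3 b v \<noteq> 0 \<Longrightarrow> b \<noteq> 0"
  using eval.subst3_zero[of "($) v"] by (auto simp: eval3_eq_subst3)

lemma local_ring_add:
  assumes "x \<in> R" "y \<in> R"
  shows "x + y \<in> R"
proof -
  obtain a b n a' b' n' where x: "x = Fract a b" "homogeneous3 n a" "homogeneous3 n b" "eval3 b v \<noteq> 0"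
    and y: "y = Fract a' b'" "homogeneous3 n' a'" "homogeneous3 n' b'" "eval3 b' v \<noteq> 0"
    using assms by (auto simp: local_ring_def')
  have "x + y = Fract (a * b' + a' * b) (b * b')"
    using x y eval3_neq_0 by simp
  moreover have "homogeneous3 (n + n') (a * b' + a' * b)"
    using x y homogeneous3_mult[of n a n' b'] homogeneous3_mult[of n' a' n b]
    by (simp add: homogeneous3_add add.commute)
  ultimately show ?thesis
    using x y by (auto simp: eval3_simps intro!: local_ringI homogeneous3_mult)
qed

lemma local_ring_mult:
  assumes "x \<in> R" "y \<in> R"
  shows "x * y \<in> R"
proof -
  obtain a b n a' b' n' where x: "x = Fract a b" "homogeneous3 n a" "homogeneous3 n b" "eval3 b v \<noteq> 0"
    and y: "y = Fract a' b'" "homogeneous3 n' a'" "homogeneous3 n' b'" "eval3 b' v \<noteq> 0"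
    using assms by (auto simp: local_ring_def')
  then show ?thesis
    by (auto simp: eval3_simps intro!: local_ringI homogeneous3_mult)
qed

lemma local_ring_const [simp]: "const_fract c \<in> R"
  by (rule local_ringI[of 0]) (auto simp: eval3_simps)

lemma local_ring_0 [simp]: "0 \<in> R" and local_ring_1 [simp]: "1 \<in> R"
  using local_ring_const[of 0] local_ring_const[of 1]
  by (simp_all add: Zero_fract_def One_fract_def del: local_ring_const)

lemma const_fract_uminus_1: "const_fract (- 1) = - 1"
  by (simp add: const3_uminus One_fract_def)

lemma local_ring_uminus: "x \<in> R \<Longrightarrow> - x \<in> R"
  using local_ring_mult[OF local_ring_const, of x "-1"] by (simp add: const_fract_uminus_1 del: const3_1)

lemma local_ring_diff: "x \<in> R \<Longrightarrow> y \<in> R \<Longrightarrow> x - y \<in> R"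
  using local_ring_add[OF _ local_ring_uminus] by fastforce

lemma local_ring_power: "x \<in> R \<Longrightarrow> x ^ n \<in> R"
  by (induction n) (auto intro: local_ring_mult)

lemma local_ring_sum: "(\<And>a. a \<in> A \<Longrightarrow> f a \<in> R) \<Longrightarrow> sum f A \<in> R"
  by (induction A rule: infinite_finite_induct) (auto intro: local_ring_add)

text \<open>The expansion \<open>J a / J b\<close> of a fraction along the parametrization, stated
  without division. It is determined once some denominator is nonzero at the point, since
  \<open>J b\<close> is then nonzero.\<close>

definition jet :: "poly3 fract \<Rightarrow> complex fps" where
  "jet x = (THE h. \<exists>a b. x = Fract a b \<and> eval3 b v \<noteq> 0 \<and> h * J b = J a)"

lemma J_neq_0: "eval3 b v \<noteq> 0 \<Longrightarrow> J b \<noteq> 0"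
  using J_nth_0[of b] by auto

text \<open>Independence of the representative: \<open>J\<close> carries the cross-multiplied
  equation \<open>a b' = a' b\<close> to power series, where \<open>J b\<close> and
  \<open>J b'\<close> cancel because their constant terms are nonzero.\<close>

lemma jet_eqI:
  assumes "eval3 b v \<noteq> 0" "h * J b = J a"
  shows "jet (Fract a b) = h"
  unfolding jet_def
proof (rule the_equality)
  show "\<exists>a' b'. Fract a b = Fract a' b' \<and> eval3 b' v \<noteq> 0 \<and> h * J b' = J a'"
    using assms by (intro exI[of _ a] exI[of _ b]) simp
next
  fix h' assume "\<exists>a' b'. Fract a b = Fract a' b' \<and> eval3 b' v \<noteq> 0 \<and> h' * J b' = J a'"
  then obtain a' b' where *: "Fract a b = Fract a' b'" "eval3 b' v \<noteq> 0" "h' * J b' = J a'"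
    by blast
  then have "a * b' = a' * b"
    using assms by (simp add: eq_fract eval3_neq_0)
  then have "J a * J b' = J a' * J b"
    by (simp flip: fps_subst.subst3_mult)
  then have "h * (J b * J b') = h' * (J b * J b')"
    by (simp add: mult_ac flip: *(3) assms(2))
  moreover have "J b * J b' \<noteq> 0"
    using * assms by (simp add: J_neq_0)
  ultimately show "h' = h"
    by simp
qed

lemma jet_Fract:
  assumes "eval3 b v \<noteq> 0"
  shows "jet (Fract a b) * J b = J a"
proof -
  have *: "fps_nth (J b) 0 \<noteq> 0"
    using assms by (simp add: J_nth_0)
  have "(J a * inverse (J b)) * J b = J a"
    by (simp only: mult.assoc inverse_mult_eq_1[OF *] mult_1_right)
  with jet_eqI[OF assms this] show ?thesis
    by (simp only:)
qed

lemma jet_add: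
  assumes "x \<in> R" "y \<in> R"
  shows "jet (x + y) = jet x + jet y"
proof -
  obtain a b a' b' where x: "x = Fract a b" "eval3 b v \<noteq> 0"
    and y: "y = Fract a' b'" "eval3 b' v \<noteq> 0"
    using assms by (auto simp: local_ring_def')
  have J_a: "J a = jet x * J b" and J_a': "J a' = jet y * J b'"
    using x y jet_Fract by simp_all
  have "x + y = Fract (a * b' + a' * b) (b * b')"
    using x y eval3_neq_0 by simp
  moreover have "(jet x + jet y) * J (b * b') = J (a * b' + a' * b)"
    by (simp add: fps_subst.subst3_add fps_subst.subst3_mult J_a J_a' algebra_simps)
  ultimately show ?thesis
    using jet_eqI[of "b * b'" "jet x + jet y" "a * b' + a' * b"] x(2) y(2) by (simp only: eval3_simps) simp
qed

lemma jet_mult: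
  assumes "x \<in> R" "y \<in> R"
  shows "jet (x * y) = jet x * jet y"
proof -
  obtain a b a' b' where x: "x = Fract a b" "eval3 b v \<noteq> 0"
    and y: "y = Fract a' b'" "eval3 b' v \<noteq> 0"
    using assms by (auto simp: local_ring_def')
  have J_a: "J a = jet x * J b" and J_a': "J a' = jet y * J b'"
    using x y jet_Fract by simp_all
  have "(jet x * jet y) * J (b * b') = J (a * a')"
    by (simp add: fps_subst.subst3_mult J_a J_a')
  moreover have "x * y = Fract (a * a') (b * b')"
    using x y by simp
  ultimately show ?thesis
    using jet_eqI[of "b * b'" "jet x * jet y" "a * a'"] x(2) y(2) by (simp only: eval3_simps) simp
qed

lemma jet_const: "jet (const_fract c) = fps_const c"
  by (rule jet_eqI) (simp_all add: eval3_simps fps_subst.subst3_simps)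

lemma jet_0': "jet 0 = 0" and jet_1: "jet 1 = 1"
  using jet_const[of 0] jet_const[of 1] by (simp_all add: Zero_fract_def One_fract_def)

lemma jet_power: "x \<in> R \<Longrightarrow> jet (x ^ n) = jet x ^ n"
  by (induction n) (simp_all add: jet_1 jet_mult local_ring_power)

lemma jet_sum: "(\<And>a. a \<in> A \<Longrightarrow> f a \<in> R) \<Longrightarrow> jet (sum f A) = (\<Sum>a\<in>A. jet (f a))"
  by (induction A rule: infinite_finite_induct) (simp_all add: jet_0' jet_add local_ring_sum)

lemma jet_diff:
  assumes "x \<in> R" "y \<in> R"
  shows "jet (x - y) = jet x - jet y"
  using jet_add[of "x - y" y] assms by (simp add: local_ring_diff)

text \<open>A nonzero constant term means that the numerator does not vanish at the point, so the
  fraction may be turned upside down.\<close>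

lemma local_ring_unit:
  assumes "x \<in> R" "fps_nth (jet x) 0 \<noteq> 0"
  obtains y where "y \<in> R" "x * y = 1"
proof -
  obtain a b n where x: "x = Fract a b" "homogeneous3 n a" "homogeneous3 n b" "eval3 b v \<noteq> 0"
    using assms by (auto simp: local_ring_def')
  have "eval3 a v \<noteq> 0"
    using assms(2) x(4) jet_Fract[OF x(4), of a] J_nth_0[of a] J_nth_0[of b] x(1)
    by (metis fps_mult_nth_0 no_zero_divisors)
  then have "Fract b a \<in> R" "x * Fract b a = 1"
    using x eval3_neq_0 by (auto simp: One_fract_def eq_fract intro!: local_ringI)
  then show thesis
    by (rule that)
qed

section \<open>Affine coordinates and the maximal ideal\<close>

definition coord :: "3 \<Rightarrow> poly3 fract" where
  "coord a = Fract (var3 a) (var3 k)"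

text \<open>The affine coordinates centred at the point, and the affine equation of the curve. By
  \<open>jet_i\<close>, \<open>\<tau>\<close> has order exactly one along the
  parametrization.\<close>

definition \<tau> :: "poly3 fract" where "\<tau> = coord i - const_fract (v $ i)"
definition \<sigma> :: "poly3 fract" where "\<sigma> = coord j - const_fract (v $ j)"
definition \<phi> :: "poly3 fract" where "\<phi> = Fract F (var3 k ^ d)"

lemma eval3_var_k: "eval3 (var3 k ^ n) v = 1"
  by (simp add: eval3_simps v_k)

lemma coord_in [simp]: "coord a \<in> R"
  unfolding coord_def by (rule local_ringI[of "Suc 0"]) (auto simp: eval3_simps v_k)

lemma coord_k: "coord k = 1"
  by (simp add: coord_def One_fract_def eq_fract)

lemma jet_coord: "jet (coord a) = g a"
  unfolding coord_def by (rule jet_eqI) (simp_all add: eval3_simps fps_subst.subst3_simps v_k jet_k)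

lemma \<tau>_in [simp]: "\<tau> \<in> R"
  by (simp add: \<tau>_def local_ring_diff)

lemma jet_\<tau>: "jet \<tau> = g i - fps_const (v $ i)"
  by (simp add: \<tau>_def jet_diff jet_coord jet_const)

lemma jet_\<tau>_nth: "fps_nth (jet \<tau>) 0 = 0" "fps_nth (jet \<tau>) 1 \<noteq> 0"
  using jet_i by (simp_all add: jet_\<tau> jet_0)

lemma Fract_var_k_in: "homogeneous3 n f \<Longrightarrow> Fract f (var3 k ^ n) \<in> R"
  using homogeneous3_power[OF homogeneous3_var, of n k]
  by (auto simp: eval3_var_k intro!: local_ringI)

lemma jet_Fract_var_k: "jet (Fract f (var3 k ^ n)) = J f"
  by (rule jet_eqI) (simp_all add: eval3_var_k fps_subst.subst3_simps jet_k)

lemma \<phi>_in [simp]: "\<phi> \<in> R"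
  by (simp add: \<phi>_def Fract_var_k_in homogeneous3_fermat)

lemma jet_\<phi>_order: "fps_ord_ge 6 (jet \<phi>)"
  by (simp add: \<phi>_def jet_Fract_var_k J_fermat_order)

lemma \<phi>_eq: "\<phi> = coord i ^ d + coord j ^ d + 1"
  unfolding \<phi>_def
  by (subst Fract_homogeneous[OF homogeneous3_fermat])
    (simp add: fermat_ijk fract_subst.subst3_simps coord_k flip: coord_def)

text \<open>
  Smoothness: \<open>v\<^sub>j \<noteq> 0\<close> makes \<open>\<partial>\<phi>/\<partial>\<sigma>\<close> invertible at the point, so that \<open>\<tau>\<close> is a uniformizer modulo \<open>\<phi>\<close>.
\<close>

lemma \<sigma>_in_ideal: "\<exists>y\<in>R. \<exists>z\<in>R. \<sigma> = \<tau> * y + \<phi> * z"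
proof -
  \<comment> \<open>\<open>S a\<close> is the cofactor in \<open>x^d - c^d = (x - c) S\<close> for
    \<open>c = v $ a\<close>; its value at the point is \<open>d c^(d-1)\<close>. For
    \<open>a = j\<close> this is the derivative that has to be a unit.\<close>
  define S where "S a = (\<Sum>l<d. const_fract (v $ a) ^ (d - Suc l) * coord a ^ l)" for a
  have S_in: "S a \<in> R" for a
    unfolding S_def by (intro local_ring_sum local_ring_mult local_ring_power) auto
  have S_eq: "coord a ^ d - const_fract (v $ a) ^ d = (coord a - const_fract (v $ a)) * S a" for a
    unfolding S_def by (rule power_diff_sumr2)
  have "fps_nth (jet (S j)) 0 = (\<Sum>l<d. (v $ j) ^ (d - Suc l) * (v $ j) ^ l)"
    unfolding S_def
    by (subst jet_sum)
      (auto simp: fps_sum_nth fps_power_zeroth jet_mult jet_power local_ring_power local_ring_mult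
        jet_const jet_coord jet_0)
  also have "\<dots> = (\<Sum>l<d. (v $ j) ^ (d - 1))"
    by (intro sum.cong) (auto simp flip: power_add)
  finally have "fps_nth (jet (S j)) 0 \<noteq> 0"
    using v_j d_pos by simp
  then obtain y where y: "y \<in> R" "S j * y = 1"
    using local_ring_unit[OF S_in] by blast
  \<comment> \<open>The constant coefficient of the curve equation says that \<open>v\<close> lies
    on the curve.\<close>
  have "fps_nth (g i ^ d + g j ^ d + 1) 0 = 0"
    using jet_order unfolding fps_ord_ge_def by (metis zero_less_numeral)
  then have v: "(v $ i) ^ d + (v $ j) ^ d + 1 = 0"
    by (simp add: fps_power_zeroth jet_0)
  have hom_power: "const_fract c ^ n = const_fract (c ^ n)" for c n
    by (induction n) (simp_all add: One_fract_def const3_mult)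
  have "const_fract (v $ i) ^ d + const_fract (v $ j) ^ d + 1
      = const_fract ((v $ i) ^ d + (v $ j) ^ d + 1)"
    by (simp only: fract_subst.hom_add fract_subst.hom_one hom_power)
  then have "const_fract (v $ i) ^ d + const_fract (v $ j) ^ d + 1 = 0"
    by (simp only: v const3_0 Zero_fract_def)
  moreover have "\<phi> = (coord i ^ d - const_fract (v $ i) ^ d) + (coord j ^ d - const_fract (v $ j) ^ d)
      + (const_fract (v $ i) ^ d + const_fract (v $ j) ^ d + 1)"
    unfolding \<phi>_eq by (simp only: algebra_simps)
  ultimately have "\<phi> = (coord i ^ d - const_fract (v $ i) ^ d) + (coord j ^ d - const_fract (v $ j) ^ d)"
    by simp
  also have "\<dots> = \<tau> * S i + \<sigma> * S j"
    by (simp only: S_eq \<tau>_def \<sigma>_def)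
  finally have "\<phi> * y = \<tau> * (S i * y) + \<sigma> * (S j * y)"
    by (simp only: distrib_right mult.assoc)
  then have "\<sigma> = \<tau> * (- (S i * y)) + \<phi> * y"
    unfolding y(2) by algebra
  with y(1) S_in show ?thesis
    by (meson local_ring_mult local_ring_uminus)
qed

text \<open>Generated by the uniformizer and the equation of the curve. It contains
  \<open>\<sigma>\<close>, and so turns out to contain every function vanishing at the
  point.\<close>

definition max_ideal :: "poly3 fract set" where
  "max_ideal = {\<tau> * y + \<phi> * z | y z. y \<in> R \<and> z \<in> R}"

lemma max_ideal_add: "x \<in> max_ideal \<Longrightarrow> y \<in> max_ideal \<Longrightarrow> x + y \<in> max_ideal"
  unfolding max_ideal_def
proof safe
  fix y z y' z' assume "y \<in> R" "z \<in> R" "y' \<in> R" "z' \<in> R"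
  moreover have "(\<tau> * y + \<phi> * z) + (\<tau> * y' + \<phi> * z') = \<tau> * (y + y') + \<phi> * (z + z')"
    by (simp only: distrib_left add_ac)
  ultimately show "\<exists>ya za. (\<tau> * y + \<phi> * z) + (\<tau> * y' + \<phi> * z') = \<tau> * ya + \<phi> * za \<and> ya \<in> R \<and> za \<in> R"
    by (meson local_ring_add)
qed

lemma max_ideal_mult: "x \<in> max_ideal \<Longrightarrow> r \<in> R \<Longrightarrow> r * x \<in> max_ideal"
  unfolding max_ideal_def
proof safe
  fix y z assume "y \<in> R" "z \<in> R" "r \<in> R"
  moreover have "r * (\<tau> * y + \<phi> * z) = \<tau> * (r * y) + \<phi> * (r * z)"
    by (simp only: distrib_left mult_ac)
  ultimately show "\<exists>ya za. r * (\<tau> * y + \<phi> * z) = \<tau> * ya + \<phi> * za \<and> ya \<in> R \<and> za \<in> R"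
    by (meson local_ring_mult)
qed

lemma max_idealI: "y \<in> R \<Longrightarrow> z \<in> R \<Longrightarrow> x = \<tau> * y + \<phi> * z \<Longrightarrow> x \<in> max_ideal"
  unfolding max_ideal_def by blast

lemma zero_in_max_ideal: "0 \<in> max_ideal"
  by (rule max_idealI[of 0 0]) simp_all

lemma \<tau>_in_max_ideal: "\<tau> \<in> max_ideal"
  by (rule max_idealI[of 1 0]) simp_all

lemma \<sigma>_in_max_ideal: "\<sigma> \<in> max_ideal"
  unfolding max_ideal_def using \<sigma>_in_ideal by blast

text \<open>Congruence to a constant modulo \<open>max_ideal\<close>. Being compatible with sums and
  products, it carries evaluation at \<open>v\<close> from the coordinates to all
  polynomials.\<close>

definition has_value :: "poly3 fract \<Rightarrow> complex \<Rightarrow> bool" where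
  "has_value x c \<longleftrightarrow> x \<in> R \<and> x - const_fract c \<in> max_ideal"

lemma has_value_const: "has_value (const_fract c) c"
  by (simp add: has_value_def zero_in_max_ideal)

lemma has_value_add:
  assumes "has_value x c" "has_value y e"
  shows "has_value (x + y) (c + e)"
proof -
  have "x + y - const_fract (c + e) = (x - const_fract c) + (y - const_fract e)"
    by (simp only: fract_subst.hom_add) algebra
  with assms show ?thesis
    unfolding has_value_def by (metis max_ideal_add local_ring_add)
qed

lemma has_value_mult:
  assumes "has_value x c" "has_value y e"
  shows "has_value (x * y) (c * e)"
proof -
  have "x * y - const_fract (c * e) = y * (x - const_fract c) + const_fract c * (y - const_fract e)"
    by (simp only: fract_subst.hom_mult) algebra
  with assms show ?thesis
    unfolding has_value_def by (metis max_ideal_add max_ideal_mult local_ring_mult local_ring_const)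
qed

lemma has_value_1: "has_value 1 1"
  using has_value_const[of 1] by (simp add: One_fract_def)

lemma has_value_power: "has_value x c \<Longrightarrow> has_value (x ^ n) (c ^ n)"
  by (induction n) (auto intro: has_value_1 has_value_mult)

lemma has_value_prod: "(\<And>a. a \<in> A \<Longrightarrow> has_value (f a) (h a)) \<Longrightarrow> has_value (prod f A) (prod h A)"
  by (induction A rule: infinite_finite_induct) (auto intro: has_value_1 has_value_mult)

lemma has_value_coord: "has_value (coord a) (v $ a)"
proof -
  have "a = i \<or> a = j \<or> a = k"
    using UNIV_ijk by blast
  then show ?thesis
    using has_value_1 \<tau>_in_max_ideal \<sigma>_in_max_ideal
    by (auto simp: coord_k v_k) (auto simp: has_value_def \<tau>_def \<sigma>_def)
qed

lemma has_value_subst3: "has_value (subst3 const_fract coord f) (eval3 f v)"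
proof (induction f rule: poly3_induct)
  case zero
  show ?case
    using has_value_const[of 0] by (simp add: eval3_eq_subst3 Zero_fract_def)
next
  case (single m c)
  show ?case
    unfolding eval3_eq_subst3 fract_subst.subst3_single eval.subst3_single
    by (intro has_value_mult has_value_const has_value_prod has_value_power has_value_coord)
next
  case (add f g)
  then show ?case
    unfolding eval3_eq_subst3 fract_subst.subst3_add eval.subst3_add
    by (rule has_value_add)
qed

text \<open>The numerator vanishes at \<open>v\<close>, so after dehomogenization it is congruent to
  0; the remaining factor \<open>x_k^n / b\<close> lies in the local ring.\<close>

lemma vanishing_in_max_ideal:
  assumes "x \<in> R" "fps_nth (jet x) 0 = 0"
  shows "x \<in> max_ideal"
proof -
  obtain a b n where x: "x = Fract a b" "homogeneous3 n a" "homogeneous3 n b" "eval3 b v \<noteq> 0"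
    using assms by (auto simp: local_ring_def')
  have "fps_nth (jet x * J b) 0 = eval3 a v"
    by (simp only: x(1) jet_Fract[OF x(4)] J_nth_0)
  then have "eval3 a v = 0"
    using assms by simp
  then have "Fract a (var3 k ^ n) \<in> max_ideal"
    using has_value_subst3[of a] Fract_homogeneous[OF x(2), of k]
    by (simp add: has_value_def coord_def[abs_def] flip: Zero_fract_def)
  moreover have "Fract (var3 k ^ n) b \<in> R"
    using x homogeneous3_power[OF homogeneous3_var, of n k] by (auto intro!: local_ringI)
  moreover have "x = Fract (var3 k ^ n) b * Fract a (var3 k ^ n)"
    using x by (simp add: eq_fract eval3_neq_0)
  ultimately show ?thesis
    by (metis max_ideal_mult)
qed

text \<open>One factor \<open>\<tau>\<close> is split off at a time: if
  \<open>\<tau>^n y + \<phi> z\<close> has no coefficient in degree \<open>n\<close>, then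
  \<open>y\<close> vanishes at the point and lies in \<open>max_ideal\<close>. The bound 6 ensures
  that \<open>\<phi>\<close> contributes nothing in these degrees.\<close>

lemma jet_order_decomp:
  assumes "n \<le> 6" "x \<in> R" "fps_ord_ge n (jet x)"
  shows "\<exists>y\<in>R. \<exists>z\<in>R. x = \<tau> ^ n * y + \<phi> * z"
  using assms
proof (induction n)
  case 0
  then show ?case
    by (intro bexI[of _ x] bexI[of _ 0]) auto
next
  case (Suc n)
  then obtain y z where yz: "y \<in> R" "z \<in> R" "x = \<tau> ^ n * y + \<phi> * z"
    by (force simp: fps_ord_ge_def)
  have "fps_nth (jet \<phi> * jet z) n = 0"
    using fps_ord_ge_mult[OF jet_\<phi>_order] Suc.prems by (simp add: fps_ord_ge_def)
  moreover have "jet x = jet \<tau> ^ n * jet y + jet \<phi> * jet z"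
    using yz by (simp add: jet_add jet_mult jet_power local_ring_mult local_ring_power)
  ultimately have "fps_nth (jet \<tau>) 1 ^ n * fps_nth (jet y) 0 = 0"
    using Suc.prems(3)[unfolded fps_ord_ge_def, rule_format, of n]
    by (simp only: fps_add_nth fps_nth_mult_power[OF jet_\<tau>_nth(1)] lessI add_0_right simp_thms)
  then have "y \<in> max_ideal"
    using jet_\<tau>_nth(2) yz(1) vanishing_in_max_ideal by simp
  then obtain y' z' where y': "y' \<in> R" "z' \<in> R" "y = \<tau> * y' + \<phi> * z'"
    unfolding max_ideal_def by blast
  have "x = \<tau> ^ Suc n * y' + \<phi> * (\<tau> ^ n * z' + z)"
    unfolding yz(3) y'(3) by (simp add: algebra_simps)
  moreover have "\<tau> ^ n * z' + z \<in> R"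
    using yz y' by (intro local_ring_add local_ring_mult local_ring_power \<tau>_in)
  ultimately show ?case
    using y'(1) by blast
qed

text \<open>Taylor expansion in \<open>\<tau>\<close> modulo \<open>\<phi>\<close>: the next
  coefficient is the value of the cofactor \<open>y\<close> at the point, and \<open>y\<close> minus
  this value lies in \<open>max_ideal\<close>.\<close>

lemma jet_expansion:
  assumes "x \<in> R"
  shows "\<exists>c. \<exists>y\<in>R. \<exists>z\<in>R. x = (\<Sum>m<n. const_fract (c m) * \<tau> ^ m) + \<tau> ^ n * y + \<phi> * z"
proof (induction n)
  case 0
  with assms show ?case
    by (intro exI bexI[of _ x] bexI[of _ 0]) auto
next
  case (Suc n)
  then obtain c y z where *: "y \<in> R" "z \<in> R"
      "x = (\<Sum>m<n. const_fract (c m) * \<tau> ^ m) + \<tau> ^ n * y + \<phi> * z"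
    by blast
  define e where "e = fps_nth (jet y) 0"
  have "y - const_fract e \<in> max_ideal"
    using * by (intro vanishing_in_max_ideal) (simp_all add: local_ring_diff jet_diff jet_const e_def)
  then obtain y' z' where y': "y' \<in> R" "z' \<in> R" "y - const_fract e = \<tau> * y' + \<phi> * z'"
    unfolding max_ideal_def by blast
  then have y: "y = const_fract e + \<tau> * y' + \<phi> * z'"
    by algebra
  have "(\<Sum>m<n. const_fract ((c(n := e)) m) * \<tau> ^ m) = (\<Sum>m<n. const_fract (c m) * \<tau> ^ m)"
    by (intro sum.cong) auto
  then have "x = (\<Sum>m<Suc n. const_fract ((c(n := e)) m) * \<tau> ^ m) + \<tau> ^ Suc n * y' + \<phi> * (\<tau> ^ n * z' + z)"
    unfolding *(3) by (subst y) (simp add: algebra_simps)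
  moreover have "\<tau> ^ n * z' + z \<in> R"
    using * y' by (intro local_ring_add local_ring_mult local_ring_power \<tau>_in)
  ultimately show ?case
    using y'(1) by blast
qed

section \<open>The local ideal of two forms and its codimension\<close>

lemma local_idealI:
  "homogeneous3 n (r * f + s * h) \<Longrightarrow> homogeneous3 n b \<Longrightarrow> eval3 b v \<noteq> 0 \<Longrightarrow>
    x = Fract (r * f + s * h) b \<Longrightarrow> x \<in> local_ideal p f h"
  unfolding local_ideal_def' by blast

lemma local_ideal_add:
  assumes "x \<in> local_ideal p f h" "y \<in> local_ideal p f h"
  shows "x + y \<in> local_ideal p f h"
proof -
  obtain r s b n where x: "x = Fract (r * f + s * h) b"
      "homogeneous3 n (r * f + s * h)" "homogeneous3 n b" "eval3 b v \<noteq> 0"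
    using assms(1) by (auto simp: local_ideal_def')
  obtain r' s' b' n' where y: "y = Fract (r' * f + s' * h) b'"
      "homogeneous3 n' (r' * f + s' * h)" "homogeneous3 n' b'" "eval3 b' v \<noteq> 0"
    using assms(2) by (auto simp: local_ideal_def')
  let ?a = "(r * b' + r' * b) * f + (s * b' + s' * b) * h"
  have a: "?a = (r * f + s * h) * b' + (r' * f + s' * h) * b"
    by (simp add: algebra_simps)
  then have "x + y = Fract ?a (b * b')"
    using x y by (simp add: eval3_neq_0)
  moreover have "homogeneous3 (n + n') ?a"
    unfolding a using homogeneous3_mult[OF x(2) y(3)] homogeneous3_mult[OF y(2) x(3)]
    by (simp add: homogeneous3_add add.commute)
  moreover have "homogeneous3 (n + n') (b * b')" "eval3 (b * b') v \<noteq> 0"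
    using x y by (simp_all add: homogeneous3_mult eval3_simps)
  ultimately show ?thesis
    by (intro local_idealI)
qed

lemma local_ideal_mult:
  assumes "x \<in> R" "y \<in> local_ideal p f h"
  shows "x * y \<in> local_ideal p f h"
proof -
  obtain a b n where x: "x = Fract a b"
      "homogeneous3 n a" "homogeneous3 n b" "eval3 b v \<noteq> 0"
    using assms(1) by (auto simp: local_ring_def')
  obtain r' s' b' n' where y: "y = Fract (r' * f + s' * h) b'"
      "homogeneous3 n' (r' * f + s' * h)" "homogeneous3 n' b'" "eval3 b' v \<noteq> 0"
    using assms(2) by (auto simp: local_ideal_def')
  let ?a = "(a * r') * f + (a * s') * h"
  have a: "?a = a * (r' * f + s' * h)"
    by (simp add: algebra_simps)
  then have "x * y = Fract ?a (b * b')"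
    using x y by simp
  moreover have "homogeneous3 (n + n') ?a"
    unfolding a using homogeneous3_mult[OF x(2) y(2)] .
  moreover have "homogeneous3 (n + n') (b * b')" "eval3 (b * b') v \<noteq> 0"
    using x y by (simp_all add: homogeneous3_mult eval3_simps)
  ultimately show ?thesis
    by (intro local_idealI)
qed

lemma local_ideal_zero: "0 \<in> local_ideal p f h"
  by (rule local_idealI[of 0 0 f 0 h 1]) (simp_all add: eval3_simps Zero_fract_def)

lemma local_ideal_sum:
  "(\<And>a. a \<in> A \<Longrightarrow> u a \<in> local_ideal p f h) \<Longrightarrow> sum u A \<in> local_ideal p f h"
  by (induction A rule: infinite_finite_induct) (auto intro: local_ideal_add local_ideal_zero)

lemma Fract_in_local_ideal1: "homogeneous3 n f \<Longrightarrow> Fract f (var3 k ^ n) \<in> local_ideal p f h"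
  using homogeneous3_power[OF homogeneous3_var, of n k]
  by (intro local_idealI[of n 1 f 0 h "var3 k ^ n"]) (simp_all add: eval3_var_k)

lemma \<phi>_in_local_ideal: "\<phi> \<in> local_ideal p f F"
  using homogeneous3_power[OF homogeneous3_var, of d k] homogeneous3_fermat
  by (intro local_idealI[of d 0 f 1 F "var3 k ^ d"]) (simp_all add: eval3_var_k \<phi>_def)

text \<open>Along the parametrization both \<open>f\<close> and the Fermat form have order at least
  \<open>n\<close>, hence so has every combination; the denominator becomes a unit and does not
  change the order.\<close>

lemma local_ideal_jet_order:
  assumes "x \<in> local_ideal p f F" "fps_ord_ge n (J f)" "n \<le> 6"
  shows "fps_ord_ge n (jet x)"
proof -
  obtain r s b where x: "x = Fract (r * f + s * F) b" "eval3 b v \<noteq> 0"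
    using assms(1) by (auto simp: local_ideal_def')
  have "fps_ord_ge n (J F)"
    using J_fermat_order \<open>n \<le> 6\<close> by (simp add: fps_ord_ge_def)
  then have "fps_ord_ge n (J f * J r + J F * J s)"
    using assms by (intro fps_ord_ge_add fps_ord_ge_mult)
  also have "J f * J r + J F * J s = jet x * J b"
    using x jet_Fract[OF x(2)] by (simp add: fps_subst.subst3_simps mult_ac)
  finally show ?thesis
    by (rule fps_ord_ge_mult_unit) (simp add: J_nth_0 x(2))
qed

text \<open>Dehomogenized, \<open>f\<close> is \<open>\<tau>^l y + \<phi> z\<close>, and its nonzero
  coefficient in degree \<open>l\<close> makes \<open>y\<close> a unit. The relation can then be
  solved for \<open>\<tau>^l\<close>.\<close>

lemma \<tau>_power_in_local_ideal:
  assumes "homogeneous3 e f" "fps_ord_ge l (J f)" "fps_nth (J f) l \<noteq> 0" "l < 6"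
  shows "\<tau> ^ l \<in> local_ideal p f F"
proof -
  let ?x = "Fract f (var3 k ^ e)"
  have x_in: "?x \<in> R"
    using assms(1) by (rule Fract_var_k_in)
  obtain y z where yz: "y \<in> R" "z \<in> R" "?x = \<tau> ^ l * y + \<phi> * z"
    using jet_order_decomp[of l ?x] x_in assms by (auto simp: jet_Fract_var_k)
  have "fps_nth (jet \<phi> * jet z) l = 0"
    using fps_ord_ge_mult[OF jet_\<phi>_order] assms(4) by (simp add: fps_ord_ge_def)
  moreover have "jet ?x = jet \<tau> ^ l * jet y + jet \<phi> * jet z"
    unfolding yz(3) using yz(1,2) by (simp add: jet_add jet_mult jet_power local_ring_mult local_ring_power)
  ultimately have "fps_nth (jet y) 0 \<noteq> 0"
    using assms(3) by (auto simp: fps_nth_mult_power jet_\<tau>_nth(1) jet_Fract_var_k)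
  then obtain y' where y': "y' \<in> R" "y * y' = 1"
    using local_ring_unit yz(1) by blast
  have "\<tau> ^ l = \<tau> ^ l * (y * y')"
    by (simp add: y'(2))
  also have "\<dots> = y' * ?x + (- (y' * z)) * \<phi>"
    unfolding yz(3) by (simp add: algebra_simps)
  finally show ?thesis
    using yz(2) y'(1)
    by (simp only:) (intro local_ideal_add local_ideal_mult local_ring_mult local_ring_uminus
      Fract_in_local_ideal1[OF assms(1)] \<phi>_in_local_ideal)
qed

text \<open>The powers of \<open>\<tau>\<close> below \<open>n\<close> are independent modulo the
  ideal, because elements of the ideal have order at least \<open>n\<close>.\<close>

lemma intersection_mult_ge:
  assumes "fps_ord_ge n (J f)" "n \<le> 6"
  shows "enat n \<le> intersection_mult p f F"
proof -
  let ?B = "(\<lambda>m. \<tau> ^ m) ` {..<n}"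
  \<comment> \<open>\<open>quotient_dim\<close> counts sets, so the powers must be distinct; the
    coefficient in degree \<open>m\<close> separates \<open>\<tau>^m\<close> from all higher
    powers.\<close>
  have inj: "inj_on (\<lambda>m. \<tau> ^ m) {..<n}"
  proof (rule linorder_inj_onI)
    fix m l :: nat assume "m < l"
    then have "fps_nth (jet (\<tau> ^ m)) m \<noteq> fps_nth (jet (\<tau> ^ l)) m"
      using jet_\<tau>_nth startsby_zero_power_prefix[OF jet_\<tau>_nth(1)]
      by (simp add: jet_power startsby_zero_power_nth_same[OF jet_\<tau>_nth(1)])
    then show "\<tau> ^ m \<noteq> \<tau> ^ l"
      by metis
  qed auto
  have "c b = 0" if sum: "(\<Sum>b\<in>?B. const_fract (c b) * b) \<in> local_ideal p f F" and "b \<in> ?B" for c b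
  proof -
    have "jet (\<Sum>b\<in>?B. const_fract (c b) * b) = (\<Sum>m<n. fps_const (c (\<tau> ^ m)) * jet \<tau> ^ m)"
      by (simp add: sum.reindex[OF inj] jet_sum jet_mult jet_const jet_power local_ring_mult local_ring_power)
    then have "fps_ord_ge n (\<Sum>m<n. fps_const (c (\<tau> ^ m)) * jet \<tau> ^ m)"
      using local_ideal_jet_order[OF sum assms] by simp
    then have "c (\<tau> ^ m) = 0" if "m < n" for m
      using power_series_independent[OF jet_\<tau>_nth, of n "\<lambda>m. c (\<tau> ^ m)"] that by simp
    with \<open>b \<in> ?B\<close> show ?thesis
      by blast
  qed
  moreover have "card ?B = n"
    by (simp add: card_image[OF inj])
  ultimately show ?thesis
    unfolding intersection_mult_def quotient_dim_def
    by (intro Sup_upper CollectI exI[of _ ?B]) (auto simp: local_ring_power)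
qed

text \<open>Since \<open>\<tau>^l\<close> and \<open>\<phi>\<close> lie in the ideal, every element
  of the local ring is congruent to a Taylor polynomial with \<open>l\<close> coefficients. More
  than \<open>l\<close> elements therefore satisfy a nontrivial relation.\<close>

lemma intersection_mult_le:
  assumes "homogeneous3 e f" "fps_ord_ge l (J f)" "fps_nth (J f) l \<noteq> 0" "l < 6"
  shows "intersection_mult p f F \<le> enat l"
  unfolding intersection_mult_def quotient_dim_def
proof (intro Sup_least, clarify)
  let ?W = "local_ideal p f F"
  fix B assume B: "finite B" "B \<subseteq> R"
    and indep: "\<forall>c. (\<Sum>b\<in>B. const_fract (c b) * b) \<in> ?W \<longrightarrow> (\<forall>b\<in>B. c b = 0)"
  have "\<exists>c. b - (\<Sum>m<l. const_fract (c m) * \<tau> ^ m) \<in> ?W" if "b \<in> B" for b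
  proof -
    have "b \<in> R"
      using B(2) that by blast
    from jet_expansion[OF this, of l] obtain c y z where *: "y \<in> R" "z \<in> R"
        "b = (\<Sum>m<l. const_fract (c m) * \<tau> ^ m) + \<tau> ^ l * y + \<phi> * z"
      by (elim exE bexE) (rule that)
    then have "b - (\<Sum>m<l. const_fract (c m) * \<tau> ^ m) = y * \<tau> ^ l + z * \<phi>"
      by (simp add: algebra_simps)
    moreover have "y * \<tau> ^ l + z * \<phi> \<in> ?W"
      using * by (intro local_ideal_add local_ideal_mult \<tau>_power_in_local_ideal[OF assms] \<phi>_in_local_ideal)
    ultimately show ?thesis
      by (intro exI[of _ c]) (simp only:)
  qed
  then have "\<exists>c. \<forall>b\<in>B. b - (\<Sum>m<l. const_fract (c b m) * \<tau> ^ m) \<in> ?W"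
    by (intro bchoice ballI)
  then obtain c where "\<forall>b\<in>B. b - (\<Sum>m<l. const_fract (c b m) * \<tau> ^ m) \<in> ?W"
    by (elim exE) (rule that)
  note c = bspec[OF this]
  have "\<not> l < card B"
  proof
    assume "l < card B"
    then obtain e where e: "\<exists>b\<in>B. e b \<noteq> 0" "\<And>m. m < l \<Longrightarrow> (\<Sum>b\<in>B. e b * c b m) = 0"
      using homogeneous_system_nontrivial[OF B(1), of l c] by blast
    have const_sum: "const_fract (\<Sum>b\<in>A. h b) = (\<Sum>b\<in>A. const_fract (h b))" for A and h :: "poly3 fract \<Rightarrow> complex"
      by (induction A rule: infinite_finite_induct)
        (simp_all only: sum.infinite sum.empty sum.insert fract_subst.hom_add fract_subst.hom_zero simp_thms)
    \<comment> \<open>Exchanging the sums collects, for each power of \<open>\<tau>\<close>, the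
      combination of Taylor coefficients that \<open>e\<close> was chosen to annihilate.\<close>
    have "(\<Sum>b\<in>B. const_fract (e b) * (\<Sum>m<l. const_fract (c b m) * \<tau> ^ m))
        = (\<Sum>m<l. (\<Sum>b\<in>B. const_fract (e b * c b m)) * \<tau> ^ m)"
      unfolding sum_distrib_left sum_distrib_right fract_subst.hom_mult
      by (subst sum.swap) (simp only: mult.assoc)
    also have "\<dots> = 0"
    proof (intro sum.neutral ballI)
      fix m assume "m \<in> {..<l}"
      then have "(\<Sum>b\<in>B. e b * c b m) = 0"
        using e(2) by simp
      then show "(\<Sum>b\<in>B. const_fract (e b * c b m)) * \<tau> ^ m = 0"
        by (simp only: const_sum[symmetric] fract_subst.hom_zero mult_zero_left)
    qed
    finally have zero: "(\<Sum>b\<in>B. const_fract (e b) * (\<Sum>m<l. const_fract (c b m) * \<tau> ^ m)) = 0" .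
    have "(\<Sum>b\<in>B. const_fract (e b) * (b - (\<Sum>m<l. const_fract (c b m) * \<tau> ^ m))) \<in> ?W"
      by (intro local_ideal_sum local_ideal_mult c local_ring_const)
    also have "(\<Sum>b\<in>B. const_fract (e b) * (b - (\<Sum>m<l. const_fract (c b m) * \<tau> ^ m)))
        = (\<Sum>b\<in>B. const_fract (e b) * b)"
      unfolding right_diff_distrib sum_subtractf zero by simp
    finally show False
      using indep e(1) by blast
  qed
  then show "enat (card B) \<le> enat l"
    by simp
qed

text \<open>If the order is below \<open>n\<close>, the first nonzero coefficient, in degree
  \<open>l\<close>, bounds the multiplicity by \<open>l < n\<close>.\<close>

lemma intersection_mult_ge_iff:
  assumes "homogeneous3 e f" "n \<le> 6"
  shows "enat n \<le> intersection_mult p f F \<longleftrightarrow> fps_ord_ge n (J f)"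
proof
  assume n: "enat n \<le> intersection_mult p f F"
  show "fps_ord_ge n (J f)"
  proof (rule ccontr)
    assume "\<not> fps_ord_ge n (J f)"
    then have ex: "\<exists>l. l < n \<and> fps_nth (J f) l \<noteq> 0"
      by (auto simp: fps_ord_ge_def)
    define l where "l = (LEAST l. l < n \<and> fps_nth (J f) l \<noteq> 0)"
    have l: "l < n" "fps_nth (J f) l \<noteq> 0"
      using LeastI_ex[OF ex] by (auto simp: l_def)
    have "fps_ord_ge l (J f)"
      using not_less_Least[of _ "\<lambda>l. l < n \<and> fps_nth (J f) l \<noteq> 0"] l(1)
      by (auto simp: fps_ord_ge_def l_def[symmetric])
    then have "intersection_mult p f F \<le> enat l"
      using assms l by (intro intersection_mult_le) auto
    with n l(1) show False
      by (meson enat_ord_simps(1) leD order_trans)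
  qed
qed (use intersection_mult_ge assms in blast)

end

text \<open>Multinomial expansion of \<open>(1 + e T + b T^2 + c T^4)^n\<close> modulo
  \<open>T^6\<close>. Binomial coefficients appear as polynomials in \<open>n\<close>, which is also
  right for small \<open>n\<close>; the six degrees share one induction because each refers to lower
  ones.\<close>

lemma fps_power_coeffs:
  fixes f :: "complex fps"
  assumes f: "fps_nth f 0 = 1" "fps_nth f 1 = e" "fps_nth f 2 = b" "fps_nth f 3 = 0"
    "fps_nth f 4 = c" "fps_nth f 5 = 0"
  defines "r \<equiv> \<lambda>n::nat. of_nat n :: complex"
  shows "fps_nth (f ^ n) 0 = 1"
    "fps_nth (f ^ n) 1 = r n * e"
    "fps_nth (f ^ n) 2 = r n * b + r n * (r n - 1) / 2 * e\<^sup>2"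
    "fps_nth (f ^ n) 3 = r n * (r n - 1) * e * b + r n * (r n - 1) * (r n - 2) / 6 * e ^ 3"
    "fps_nth (f ^ n) 4 = r n * c + r n * (r n - 1) / 2 * b\<^sup>2 + r n * (r n - 1) * (r n - 2) / 2 * e\<^sup>2 * b
       + r n * (r n - 1) * (r n - 2) * (r n - 3) / 24 * e ^ 4"
    "fps_nth (f ^ n) 5 = r n * (r n - 1) * e * c + r n * (r n - 1) * (r n - 2) / 2 * e * b\<^sup>2
       + r n * (r n - 1) * (r n - 2) * (r n - 3) / 6 * e ^ 3 * b
       + r n * (r n - 1) * (r n - 2) * (r n - 3) * (r n - 4) / 120 * e ^ 5"
proof (induction n)
  case 0
  {
    case 1 show ?case by simp
  next
    case 2 show ?case by (simp add: r_def)
  next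
    case 3 show ?case by (simp add: r_def)
  next
    case 4 show ?case by (simp add: r_def)
  next
    case 5 show ?case by (simp add: r_def)
  next
    case 6 show ?case by (simp add: r_def)
  }
next
  case (Suc n)
  note simps = fps_mult_nth numeral_eq_Suc sum.atLeast0_atMost_Suc
  have r: "r (Suc n) = r n + 1"
    by (simp add: r_def)
  have m: "fps_nth (f * f ^ n) 0 = 1 * fps_nth (f ^ n) 0"
    "fps_nth (f * f ^ n) 1 = 1 * fps_nth (f ^ n) 1 + e * fps_nth (f ^ n) 0"
    "fps_nth (f * f ^ n) 2 = 1 * fps_nth (f ^ n) 2 + e * fps_nth (f ^ n) 1 + b * fps_nth (f ^ n) 0"
    "fps_nth (f * f ^ n) 3 = 1 * fps_nth (f ^ n) 3 + e * fps_nth (f ^ n) 2 + b * fps_nth (f ^ n) 1"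
    "fps_nth (f * f ^ n) 4 = 1 * fps_nth (f ^ n) 4 + e * fps_nth (f ^ n) 3 + b * fps_nth (f ^ n) 2
       + c * fps_nth (f ^ n) 0"
    "fps_nth (f * f ^ n) 5 = 1 * fps_nth (f ^ n) 5 + e * fps_nth (f ^ n) 4 + b * fps_nth (f ^ n) 3
       + c * fps_nth (f ^ n) 1"
    using f by (simp_all add: simps)
  {
    case 1 show ?case
      unfolding power_Suc m Suc.IH by simp
  next
    case 2 show ?case
      unfolding power_Suc m Suc.IH r by (simp add: algebra_simps)
  next
    case 3 show ?case
      unfolding power_Suc m Suc.IH r by (simp add: field_simps eval_nat_numeral)
  next
    case 4 show ?case
      unfolding power_Suc m Suc.IH r by (simp add: field_simps eval_nat_numeral)
  next
    case 5 show ?case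
      unfolding power_Suc m Suc.IH r by (simp add: field_simps eval_nat_numeral)
  next
    case 6 show ?case
      unfolding power_Suc m Suc.IH r by (simp add: field_simps eval_nat_numeral)
  }
qed

section \<open>Explicit linear and quadratic forms, and the gradient of the Fermat form\<close>

lemma single_eq_monomial:
  fixes m :: "3 \<Rightarrow>\<^sub>0 nat"
  assumes "UNIV = {i, j, k}" "i \<noteq> j" "i \<noteq> k" "j \<noteq> k"
  shows "Poly_Mapping.single m c = const3 c * var3 i ^ Poly_Mapping.lookup m i
    * var3 j ^ Poly_Mapping.lookup m j * var3 k ^ Poly_Mapping.lookup m k"
proof -
  have "m = Poly_Mapping.single i (Poly_Mapping.lookup m i) + Poly_Mapping.single j (Poly_Mapping.lookup m j)
      + Poly_Mapping.single k (Poly_Mapping.lookup m k)"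
  proof (rule poly_mapping_eqI)
    fix a
    have "a = i \<or> a = j \<or> a = k"
      using assms(1) by blast
    then show "Poly_Mapping.lookup m a = Poly_Mapping.lookup (Poly_Mapping.single i (Poly_Mapping.lookup m i)
        + Poly_Mapping.single j (Poly_Mapping.lookup m j) + Poly_Mapping.single k (Poly_Mapping.lookup m k)) a"
      using assms(2-) by (auto simp: lookup_add lookup_single when_def)
  qed
  then show ?thesis
    by (simp add: var3_power const3_def mult_single)
qed

lemma linear_form_eq:
  assumes "homogeneous3 1 f" "UNIV = {i, j, k}" "i \<noteq> j" "i \<noteq> k" "j \<noteq> k"
  shows "\<exists>a b c. f = const3 a * var3 i + const3 b * var3 j + const3 c * var3 k"
  using assms(1)
proof (induction rule: homogeneous3_induct)
  case zero
  have "0 = const3 0 * var3 i + const3 0 * var3 j + const3 0 * var3 k"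
    by simp
  then show ?case
    by blast
next
  case (single m e)
  let ?x = "Poly_Mapping.lookup m i" and ?y = "Poly_Mapping.lookup m j" and ?z = "Poly_Mapping.lookup m k"
  have "?x + ?y + ?z = 1"
    using assms(3-) single by (simp add: assms(2))
  then have "?x = 1 \<and> ?y = 0 \<and> ?z = 0 \<or> ?x = 0 \<and> ?y = 1 \<and> ?z = 0 \<or> ?x = 0 \<and> ?y = 0 \<and> ?z = 1"
    by linarith
  moreover have "Poly_Mapping.single m e = const3 e * var3 i ^ ?x * var3 j ^ ?y * var3 k ^ ?z"
    by (rule single_eq_monomial[OF assms(2-)])
  ultimately have "Poly_Mapping.single m e \<in> {const3 e * var3 i + const3 0 * var3 j + const3 0 * var3 k,
      const3 0 * var3 i + const3 e * var3 j + const3 0 * var3 k,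
      const3 0 * var3 i + const3 0 * var3 j + const3 e * var3 k}"
    by (elim disjE conjE) simp_all
  then show ?case
    by blast
next
  case (add f g)
  then obtain a b c a' b' c' where "f = const3 a * var3 i + const3 b * var3 j + const3 c * var3 k"
    "g = const3 a' * var3 i + const3 b' * var3 j + const3 c' * var3 k"
    by blast
  then have "f + g = const3 (a + a') * var3 i + const3 (b + b') * var3 j + const3 (c + c') * var3 k"
    by (simp add: const3_add algebra_simps)
  then show ?case
    by blast
qed

text \<open>The indices are parameters so that one computation serves every line of both
  arrangements.\<close>

definition quadratic_form :: "3 \<Rightarrow> 3 \<Rightarrow> 3 \<Rightarrow> complex \<Rightarrow> complex \<Rightarrow> complex \<Rightarrow> complex \<Rightarrow> complex \<Rightarrow> complex \<Rightarrow> poly3" where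
  "quadratic_form i j k a b c e f h =
     const3 a * var3 i ^ 2 + const3 b * var3 j ^ 2 + const3 c * (var3 i * var3 j)
     + const3 e * (var3 i * var3 k) + const3 f * (var3 j * var3 k) + const3 h * var3 k ^ 2"

lemma quadratic_form_add:
  "quadratic_form i j k a b c e f h + quadratic_form i j k a' b' c' e' f' h'
    = quadratic_form i j k (a + a') (b + b') (c + c') (e + e') (f + f') (h + h')"
  by (simp add: quadratic_form_def const3_add algebra_simps)

lemma quadratic_form_scale:
  "const3 s * quadratic_form i j k a b c e f h
    = quadratic_form i j k (s * a) (s * b) (s * c) (s * e) (s * f) (s * h)"
  by (simp add: quadratic_form_def const3_mult algebra_simps)

lemma homogeneous3_quadratic_form: "homogeneous3 2 (quadratic_form i j k a b c e f h)"
proof -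
  have "homogeneous3 2 (var3 a * var3 b)" for a b
    using homogeneous3_mult[OF homogeneous3_var[of a] homogeneous3_var[of b]] by (simp add: numeral_2_eq_2)
  then show ?thesis
    unfolding quadratic_form_def power2_eq_square
    by (intro homogeneous3_add homogeneous3_const_mult)
qed

lemma eval3_quadratic_form:
  "eval3 (quadratic_form i j k a b c e f h) v = a * (v $ i)\<^sup>2 + b * (v $ j)\<^sup>2 + c * (v $ i * v $ j)
    + e * (v $ i * v $ k) + f * (v $ j * v $ k) + h * (v $ k)\<^sup>2"
  by (simp add: quadratic_form_def eval3_simps)

lemma quadratic_form_eq:
  assumes "homogeneous3 2 q" "UNIV = {i, j, k}" "i \<noteq> j" "i \<noteq> k" "j \<noteq> k"
  shows "\<exists>a b c e f h. q = quadratic_form i j k a b c e f h"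
  using assms(1)
proof (induction rule: homogeneous3_induct)
  case zero
  have "0 = quadratic_form i j k 0 0 0 0 0 0"
    by (simp add: quadratic_form_def)
  then show ?case
    by (intro exI)
next
  case (single m z)
  let ?x = "Poly_Mapping.lookup m i" and ?y = "Poly_Mapping.lookup m j" and ?z = "Poly_Mapping.lookup m k"
  have "?x + ?y + ?z = 2"
    using assms(3-) single by (simp add: assms(2))
  then have "?x = 2 \<and> ?y = 0 \<and> ?z = 0 \<or> ?x = 0 \<and> ?y = 2 \<and> ?z = 0 \<or> ?x = 0 \<and> ?y = 0 \<and> ?z = 2
    \<or> ?x = 1 \<and> ?y = 1 \<and> ?z = 0 \<or> ?x = 1 \<and> ?y = 0 \<and> ?z = 1 \<or> ?x = 0 \<and> ?y = 1 \<and> ?z = 1"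
    by presburger
  moreover have "Poly_Mapping.single m z = const3 z * var3 i ^ ?x * var3 j ^ ?y * var3 k ^ ?z"
    by (rule single_eq_monomial[OF assms(2-)])
  ultimately have "Poly_Mapping.single m z \<in> {quadratic_form i j k z 0 0 0 0 0, quadratic_form i j k 0 z 0 0 0 0,
      quadratic_form i j k 0 0 z 0 0 0, quadratic_form i j k 0 0 0 z 0 0, quadratic_form i j k 0 0 0 0 z 0,
      quadratic_form i j k 0 0 0 0 0 z}"
    by (elim disjE conjE) (simp_all add: quadratic_form_def mult.assoc)
  then show ?case
    by (elim insertE emptyE) (simp only:, intro exI, rule refl)+
next
  case (add f g)
  then show ?case
    by (elim exE) (simp only: quadratic_form_add, intro exI, rule refl)
qed

lemma eval3_pderiv3_fermat:
  assumes "d > 0"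
  shows "eval3 (pderiv3 a (fermat d)) v = of_nat d * (v $ a) ^ (d - 1)"
proof -
  have superset: "pderiv3 a f = (\<Sum>m\<in>S. Poly_Mapping.single (m - Poly_Mapping.single a 1)
       (of_nat (Poly_Mapping.lookup m a) * Poly_Mapping.lookup f m))"
    if "finite S" "Poly_Mapping.keys f \<subseteq> S" for f S
    unfolding pderiv3_def using that by (intro sum.mono_neutral_left) (auto simp: in_keys_iff)
  have add: "pderiv3 a (f + g) = pderiv3 a f + pderiv3 a g" for f g
    using keys_add[of f g]
    by (simp add: superset[of "Poly_Mapping.keys f \<union> Poly_Mapping.keys g"]
      lookup_add algebra_simps sum.distrib single_add)
  have "pderiv3 a (var3 b ^ d) = (if a = b then const3 (of_nat d) * var3 a ^ (d - 1) else 0)" for b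
  proof -
    have "pderiv3 a (var3 b ^ d) = Poly_Mapping.single (Poly_Mapping.single b d - Poly_Mapping.single a 1)
       (of_nat (Poly_Mapping.lookup (Poly_Mapping.single b d) a))"
      by (simp add: var3_power pderiv3_def)
    then show ?thesis
      by (simp add: var3_power const3_def mult_single lookup_single flip: single_diff single_of_nat)
  qed
  then show ?thesis
    using exhaust_3[of a] unfolding fermat_def add
    by (auto simp: eval3_simps) 
qed

section \<open>The sextactic points and their osculating conics\<close>

locale fermat_sextactic =
  fixes d :: nat and i j k :: 3 and \<alpha> \<beta> :: complex
  assumes d_ge_3: "d \<ge> 3"
    and UNIV_ijk: "UNIV = {i, j, k}"
    and distinct_ijk: "i \<noteq> j" "i \<noteq> k" "j \<noteq> k"
    and \<alpha>_power: "\<alpha> ^ d = - 1 / 2"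
    and \<beta>_power: "\<beta> ^ d = - 1 / 2"
begin

abbreviation "n \<equiv> complex_of_nat d"

definition "pt = (\<chi> a. if a = i then \<alpha> else if a = j then \<beta> else 1)"

text \<open>
  The branch of \<open>x\<^sup>d + y\<^sup>d = 2\<close> at \<open>(1, 1)\<close> is parametrized by \<open>T = (x - y) / 2\<close>; the two constants are
  determined by the vanishing of the coefficients of \<open>T\<^sup>2\<close> and \<open>T\<^sup>4\<close>.
\<close>

definition "u1 = - (n - 1) / 2"
definition "u2 = (n - 1) * (2 * n - 1) * (n - 3) / 24"

text \<open>The sign \<open>s\<close> is 1 for \<open>x\<close> and -1 for \<open>y\<close>:
  swapping them is \<open>T \<mapsto> -T\<close>. There are no terms in \<open>T^3\<close> and
  \<open>T^5\<close> because \<open>T = (x - y) / 2\<close> is the whole odd part.\<close>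

definition branch :: "complex \<Rightarrow> complex fps" where
  "branch s = 1 + fps_const s * fps_X + fps_const u1 * fps_X ^ 2 + fps_const u2 * fps_X ^ 4"

definition param :: "3 \<Rightarrow> complex fps" where
  "param a = (if a = i then fps_const \<alpha> * branch 1 else if a = j then fps_const \<beta> * branch (- 1) else 1)"

lemma branch_nth:
  "fps_nth (branch s) 0 = 1" "fps_nth (branch s) 1 = s" "fps_nth (branch s) 2 = u1"
  "fps_nth (branch s) 3 = 0" "fps_nth (branch s) 4 = u2" "fps_nth (branch s) 5 = 0"
  by (simp_all add: branch_def)

lemma \<alpha>_neq_0: "\<alpha> \<noteq> 0" and \<beta>_neq_0: "\<beta> \<noteq> 0"
  using \<alpha>_power \<beta>_power d_ge_3 by (auto simp: power_0_left)

lemma n_neq: "n \<noteq> 0" "n \<noteq> 1" "n - 1 \<noteq> 0" "n + 1 \<noteq> 0" "2 * n - 1 \<noteq> 0"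
proof -
  show "n \<noteq> 0" "n \<noteq> 1"
    using d_ge_3 by auto
  then show "n - 1 \<noteq> 0"
    by simp
  have "of_nat (d + 1) \<noteq> (0 :: complex)"
    by (simp only: of_nat_eq_0_iff)
  then show "n + 1 \<noteq> 0"
    by (simp add: add.commute)
  have "of_nat (2 * d) \<noteq> (of_nat 1 :: complex)"
    by (simp only: of_nat_eq_iff) presburger
  then show "2 * n - 1 \<noteq> 0"
    by simp
qed

text \<open>In the sum of the two \<open>d\<close>-th powers the odd coefficients cancel by the
  swap, and \<open>u1\<close>, \<open>u2\<close> annihilate those of \<open>T^2\<close> and
  \<open>T^4\<close>.\<close>

lemma param_order: "fps_ord_ge 6 (param i ^ d + param j ^ d + 1)"
  unfolding fps_ord_ge_def
proof (intro allI impI)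
  fix m :: nat assume "m < 6"
  have "param i ^ d + param j ^ d + 1 = fps_const (- 1 / 2) * (branch 1 ^ d + branch (- 1) ^ d) + 1"
    using distinct_ijk
    by (simp add: param_def power_mult_distrib fps_const_power \<alpha>_power \<beta>_power algebra_simps)
  moreover have "fps_nth \<dots> m = 0"
  proof -
    from \<open>m < 6\<close> have "m = 0 \<or> m = 1 \<or> m = 2 \<or> m = 3 \<or> m = 4 \<or> m = 5"
      by presburger
    then have "fps_nth (branch 1 ^ d) m + fps_nth (branch (- 1) ^ d) m = (if m = 0 then 2 else 0)"
      by (elim disjE; hypsubst; unfold fps_power_coeffs[OF branch_nth])
        (simp_all add: u1_def u2_def field_simps eval_nat_numeral)
    then show ?thesis
      by simp
  qed
  ultimately show "fps_nth (param i ^ d + param j ^ d + 1) m = 0"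
    by simp
qed

sublocale fermat_jet d i j k pt param
proof
  show "fps_nth (param a) 0 = pt $ a" for a
    by (simp add: param_def pt_def branch_nth)
  show "fps_nth (param i) 1 \<noteq> 0"
    using \<alpha>_neq_0 by (simp add: param_def branch_def)
qed (use d_ge_3 UNIV_ijk distinct_ijk \<beta>_neq_0 param_order in \<open>auto simp: pt_def param_def\<close>)

text \<open>For a representative \<open>c *s pt\<close>, the tangent form has \<open>T^2\<close>
  coefficient \<open>n c^(d-1) u1 (\<alpha>^d + \<beta>^d)\<close> along the branch, which is
  nonzero since \<open>\<alpha>^d + \<beta>^d = -1\<close>.\<close>

lemma not_inflection: "\<not> inflection_point F p"
proof
  assume "inflection_point F p"
  then obtain w where w: "w \<in> p" "w \<noteq> 0" "3 \<le> intersection_mult p (tangent_form F w) F"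
    by (auto simp: inflection_point_def)
  obtain c where c: "w = c *s pt"
    using w(1) by (auto simp: vec.span_singleton)
  have "c \<noteq> 0"
    using w(2) c by auto
  have "homogeneous3 (Suc 0) (tangent_form F w)"
    unfolding tangent_form_def
    by (intro homogeneous3_sum homogeneous3_const_mult homogeneous3_var)
  then have "fps_ord_ge 3 (J (tangent_form F w))"
    using w(3) intersection_mult_ge_iff[of _ "tangent_form F w" 3] by (simp add: numeral_eq_enat)
  then have "fps_nth (J (tangent_form F w)) 2 = 0"
    by (simp add: fps_ord_ge_def)
  moreover have "J (tangent_form F w) = (\<Sum>a\<in>UNIV. fps_const (n * (w $ a) ^ (d - 1)) * param a)"
    using d_ge_3 by (simp add: tangent_form_def fps_subst.subst3_simps eval3_pderiv3_fermat)
  ultimately have "n * (w $ i) ^ (d - 1) * (\<alpha> * u1) + n * (w $ j) ^ (d - 1) * (\<beta> * u1) = 0"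
    using distinct_ijk by (simp add: sum_ijk param_def branch_nth)
  moreover have "x * z ^ (d - 1) * (z * y) = x * z ^ d * y" for x y z :: complex
    using d_ge_3 by (cases d) simp_all
  ultimately have "n * c ^ (d - 1) * u1 * (\<alpha> ^ d + \<beta> ^ d) = 0"
    using distinct_ijk d_ge_3 by (cases d) (simp_all add: c pt_def power_mult_distrib algebra_simps)
  then show False
    using n_neq \<open>c \<noteq> 0\<close> by (simp add: \<alpha>_power \<beta>_power u1_def)
qed

text \<open>Up to a factor, the solution with \<open>a = b\<close>, \<open>e = f\<close> of the
  equations that annihilate the even coefficients in \<open>J_quadratic_form\<close>.\<close>

definition "cA = n * (n + 1)"
definition "cB = - 2 * (5 * n - 3) * (n - 2)"
definition "cC = 8 * n * (n - 2)"
definition "cE = - 4 * (2 * n - 3) * (n + 1)"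

definition osc :: poly3 where
  "osc = quadratic_form i j k (cA / \<alpha>\<^sup>2) (cA / \<beta>\<^sup>2) (cB / (\<alpha> * \<beta>)) (cC / \<alpha>) (cC / \<beta>) cE"

text \<open>The divisions by \<open>\<alpha>\<close> and \<open>\<beta>\<close> absorb the scaling
  of the coordinates, so only products of the two branches remain. The odd coefficients are
  antisymmetric under the swap and involve only \<open>a - b\<close> and
  \<open>e - f\<close>.\<close>

lemma J_quadratic_form:
  fixes a b c e f h
  defines "q \<equiv> quadratic_form i j k (a / \<alpha>\<^sup>2) (b / \<beta>\<^sup>2) (c / (\<alpha> * \<beta>)) (e / \<alpha>) (f / \<beta>) h"
  shows "fps_nth (J q) 0 = a + b + c + e + f + h"
    "fps_nth (J q) 1 = 2 * (a - b) + (e - f)"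
    "fps_nth (J q) 2 = (1 + 2 * u1) * (a + b) + (2 * u1 - 1) * c + u1 * (e + f)"
    "fps_nth (J q) 3 = 2 * u1 * (a - b)"
    "fps_nth (J q) 4 = (u1\<^sup>2 + 2 * u2) * (a + b + c) + u2 * (e + f)"
    "fps_nth (J q) 5 = 2 * u2 * (a - b)"
proof -
  have "J q = fps_const (a / \<alpha>\<^sup>2) * param i ^ 2 + fps_const (b / \<beta>\<^sup>2) * param j ^ 2
      + fps_const (c / (\<alpha> * \<beta>)) * (param i * param j) + fps_const (e / \<alpha>) * param i
      + fps_const (f / \<beta>) * param j + fps_const h"
    by (simp add: q_def quadratic_form_def fps_subst.subst3_simps jet_k)
  also have "\<dots> = (fps_const (a / \<alpha>\<^sup>2) * fps_const (\<alpha>\<^sup>2)) * (branch 1 * branch 1)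
      + (fps_const (b / \<beta>\<^sup>2) * fps_const (\<beta>\<^sup>2)) * (branch (- 1) * branch (- 1))
      + (fps_const (c / (\<alpha> * \<beta>)) * fps_const (\<alpha> * \<beta>)) * (branch 1 * branch (- 1))
      + (fps_const (e / \<alpha>) * fps_const \<alpha>) * branch 1
      + (fps_const (f / \<beta>) * fps_const \<beta>) * branch (- 1) + fps_const h"
    using distinct_ijk
    by (simp only: param_def distinct_ijk distinct_ijk[symmetric] simp_thms if_True if_False fps_const_mult[symmetric] power2_eq_square mult_ac)
  also have "\<dots> = fps_const a * (branch 1 * branch 1) + fps_const b * (branch (- 1) * branch (- 1))
      + fps_const c * (branch 1 * branch (- 1)) + fps_const e * branch 1 + fps_const f * branch (- 1)
      + fps_const h"
    using \<alpha>_neq_0 \<beta>_neq_0 by simp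
  finally have J_q: "J q = \<dots>" .
  \<comment> \<open>Used for equal signs and for \<open>s = - t\<close>; in the mixed product
    \<open>s + t = 0\<close> removes the odd terms.\<close>
  have prod: "fps_nth (branch s * branch t) 0 = 1"
    "fps_nth (branch s * branch t) 1 = s + t"
    "fps_nth (branch s * branch t) 2 = 2 * u1 + s * t"
    "fps_nth (branch s * branch t) 3 = (s + t) * u1"
    "fps_nth (branch s * branch t) 4 = u1\<^sup>2 + 2 * u2"
    "fps_nth (branch s * branch t) 5 = (s + t) * u2" for s t
  proof -
    note simps = fps_mult_nth numeral_eq_Suc sum.atLeast0_atMost_Suc
    have "fps_nth (f * g) 2 = fps_nth f 0 * fps_nth g 2 + fps_nth f 1 * fps_nth g 1 + fps_nth f 2 * fps_nth g 0"
      "fps_nth (f * g) 3 = fps_nth f 0 * fps_nth g 3 + fps_nth f 1 * fps_nth g 2 + fps_nth f 2 * fps_nth g 1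
        + fps_nth f 3 * fps_nth g 0"
      "fps_nth (f * g) 4 = fps_nth f 0 * fps_nth g 4 + fps_nth f 1 * fps_nth g 3 + fps_nth f 2 * fps_nth g 2
        + fps_nth f 3 * fps_nth g 1 + fps_nth f 4 * fps_nth g 0"
      "fps_nth (f * g) 5 = fps_nth f 0 * fps_nth g 5 + fps_nth f 1 * fps_nth g 4 + fps_nth f 2 * fps_nth g 3
        + fps_nth f 3 * fps_nth g 2 + fps_nth f 4 * fps_nth g 1 + fps_nth f 5 * fps_nth g 0" for f g :: "complex fps"
      by (simp_all add: simps)
    note * = this[where f = "branch s" and g = "branch t", unfolded branch_nth]
    show "fps_nth (branch s * branch t) 0 = 1" "fps_nth (branch s * branch t) 1 = s + t"
      using branch_nth[of s] branch_nth[of t] by (simp_all add: fps_mult_nth_1)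
    show "fps_nth (branch s * branch t) 2 = 2 * u1 + s * t"
      "fps_nth (branch s * branch t) 3 = (s + t) * u1"
      "fps_nth (branch s * branch t) 4 = u1\<^sup>2 + 2 * u2"
      "fps_nth (branch s * branch t) 5 = (s + t) * u2"
      unfolding * by (simp_all add: algebra_simps power2_eq_square)
  qed
  show "fps_nth (J q) 0 = a + b + c + e + f + h"
    "fps_nth (J q) 1 = 2 * (a - b) + (e - f)"
    "fps_nth (J q) 2 = (1 + 2 * u1) * (a + b) + (2 * u1 - 1) * c + u1 * (e + f)"
    "fps_nth (J q) 3 = 2 * u1 * (a - b)"
    "fps_nth (J q) 4 = (u1\<^sup>2 + 2 * u2) * (a + b + c) + u2 * (e + f)"
    "fps_nth (J q) 5 = 2 * u2 * (a - b)"
    unfolding J_q fps_add_nth fps_mult_left_const_nth prod branch_nth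
    by (simp_all add: algebra_simps)
qed

text \<open>Odd coefficients vanish by symmetry in \<open>x\<close> and \<open>y\<close>, which
  lifts the contact from 5 to 6; the even ones vanish by the choice of the constants.\<close>

lemma osc_order: "fps_ord_ge 6 (J osc)"
  unfolding fps_ord_ge_def
proof (intro allI impI)
  fix m :: nat assume "m < 6"
  then have "m = 0 \<or> m = 1 \<or> m = 2 \<or> m = 3 \<or> m = 4 \<or> m = 5"
    by presburger
  then show "fps_nth (J osc) m = 0"
    unfolding osc_def
    by (elim disjE; simp only: J_quadratic_form)
      (simp_all add: cA_def cB_def cC_def cE_def u1_def u2_def field_simps eval_nat_numeral)
qed

lemma cA_neq_0: "cA \<noteq> 0"
  using n_neq by (simp add: cA_def)

text \<open>Sorted by powers of \<open>1 / \<alpha>\<close>: along a fixed line only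
  \<open>\<alpha>\<close> changes from one conic to the next.\<close>

lemma eval3_osc:
  "eval3 osc w = cA * (w $ i)\<^sup>2 * (1 / \<alpha>)\<^sup>2
    + w $ i * (cB * (w $ j / \<beta>) + cC * w $ k) * (1 / \<alpha>)
    + (cA * (w $ j / \<beta>)\<^sup>2 + cC * (w $ j / \<beta>) * w $ k + cE * (w $ k)\<^sup>2)"
  using \<alpha>_neq_0 \<beta>_neq_0
  by (simp add: osc_def eval3_quadratic_form field_simps power2_eq_square)

lemma discriminant_neq_0: "cC\<^sup>2 - 4 * cA * cE \<noteq> 0"
proof -
  have "cC\<^sup>2 - 4 * cA * cE = 48 * n * (n - 1)\<^sup>2 * (2 * n - 1)"
    by (simp add: cA_def cC_def cE_def algebra_simps power2_eq_square)
  then show ?thesis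
    using n_neq by simp
qed

lemma conic_osc: "conic osc"
proof -
  \<comment> \<open>The unit vector in direction \<open>i\<close> reads off the coefficient
    \<open>cA / \<alpha>^2\<close>.\<close>
  define w :: "complex^3" where "w = (\<chi> a. if a = i then 1 else 0)"
  have "eval3 osc w \<noteq> 0"
    using distinct_ijk cA_neq_0 \<alpha>_neq_0 by (simp add: osc_def eval3_quadratic_form w_def)
  then have "osc \<noteq> 0"
    by (auto simp: eval3_simps)
  then show ?thesis
    by (simp add: conic_def osc_def homogeneous3_quadratic_form)
qed

text \<open>The coefficient of \<open>T^3\<close> forces \<open>a = b\<close>, then that of
  \<open>T\<close> forces \<open>e = f\<close>. After subtracting a multiple of \<open>osc\<close>,
  the coefficients of \<open>T^2\<close> and \<open>T^4\<close> give a nonsingular system of two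
  equations.\<close>

lemma osc_unique:
  assumes "conic Q" "5 \<le> intersection_mult p Q F"
  shows "\<exists>s. Q = const3 s * osc"
proof -
  have "homogeneous3 2 Q"
    using assms(1) by (simp add: conic_def)
  then obtain a' b' c' e' f' h where Q': "Q = quadratic_form i j k a' b' c' e' f' h"
    using quadratic_form_eq[OF _ UNIV_ijk distinct_ijk, of Q] by (elim exE meta_impE)
  \<comment> \<open>Coefficients in the rescaled coordinates, the shape that
    \<open>J_quadratic_form\<close> expects.\<close>
  define a b c e f where "a = a' * \<alpha>\<^sup>2" "b = b' * \<beta>\<^sup>2" "c = c' * (\<alpha> * \<beta>)" "e = e' * \<alpha>" "f = f' * \<beta>"
  have Q: "Q = quadratic_form i j k (a / \<alpha>\<^sup>2) (b / \<beta>\<^sup>2) (c / (\<alpha> * \<beta>)) (e / \<alpha>) (f / \<beta>) h"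
    using \<alpha>_neq_0 \<beta>_neq_0 by (simp add: Q' a_b_c_e_f_def)
  have "fps_ord_ge 5 (J Q)"
    using assms(2) intersection_mult_ge_iff[OF \<open>homogeneous3 2 Q\<close>, of 5] by (simp add: numeral_eq_enat)
  then have J: "fps_nth (J Q) 0 = 0" "fps_nth (J Q) 1 = 0" "fps_nth (J Q) 2 = 0" "fps_nth (J Q) 3 = 0"
    "fps_nth (J Q) 4 = 0"
    by (simp_all add: fps_ord_ge_def)
  note J = J[unfolded Q J_quadratic_form]
  have u1: "u1 \<noteq> 0"
    using n_neq by (simp add: u1_def)
  have ba: "b = a"
    using J(4) u1 by simp
  have fe: "f = e"
    using J(2) ba by simp
  \<comment> \<open>The scalar is fixed by matching the coefficients of \<open>x^2\<close>.\<close>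
  define s where "s = a / cA"
  have a: "a = s * cA"
    using cA_neq_0 by (simp add: s_def)
  have osc: "2 * (1 + 2 * u1) * cA + (2 * u1 - 1) * cB + 2 * u1 * cC = 0"
    "(u1\<^sup>2 + 2 * u2) * (2 * cA + cB) + 2 * u2 * cC = 0" "2 * cA + cB + 2 * cC + cE = 0"
    by (simp_all add: cA_def cB_def cC_def cE_def u1_def u2_def field_simps eval_nat_numeral)
  \<comment> \<open>The deviations of \<open>c\<close> and \<open>e\<close> from \<open>s\<close>
    times the conic; they satisfy the homogeneous versions of the \<open>T^2\<close> and
    \<open>T^4\<close> equations.\<close>
  define x y where "x = c - s * cB" "y = e - s * cC"
  have 1: "(2 * u1 - 1) * x + 2 * u1 * y = 0"
    using J(3) osc(1) unfolding ba fe a x_y_def by algebra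
  have 2: "(u1\<^sup>2 + 2 * u2) * x + 2 * u2 * y = 0"
    using J(5) osc(2) unfolding ba fe a x_y_def by algebra
  \<comment> \<open>Elimination of \<open>y\<close>; the factor is the determinant of the
    system.\<close>
  have "((2 * u1 - 1) * (2 * u2) - 2 * u1 * (u1\<^sup>2 + 2 * u2)) * x = 0"
    using 1 2 by algebra
  moreover have "(2 * u1 - 1) * (2 * u2) - 2 * u1 * (u1\<^sup>2 + 2 * u2) = n * (n + 1) * (n - 1) / 12"
    by (simp add: u1_def u2_def field_simps eval_nat_numeral)
  ultimately have "x = 0"
    using n_neq by simp
  then have "y = 0"
    using 1 u1 by simp
  have "c = s * cB" "e = s * cC"
    using \<open>x = 0\<close> \<open>y = 0\<close> by (simp_all add: x_y_def)
  moreover have "h = s * cE"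
    using J(1) osc(3) unfolding ba fe a calculation by algebra
  ultimately have "Q = const3 s * osc"
    unfolding Q osc_def quadratic_form_scale by (simp add: ba fe a)
  then show ?thesis ..
qed

lemma hyperosculating_osc: "hyperosculating_conic F p osc"
proof -
  have "enat 6 \<le> intersection_mult p osc F"
    using intersection_mult_ge_iff[of 2 osc 6] osc_order conic_osc by (simp add: conic_def)
  moreover then have "enat 5 \<le> intersection_mult p osc F"
    by (rule order_trans[rotated]) simp
  ultimately show ?thesis
    using osc_unique conic_osc
    by (simp add: hyperosculating_conic_def osculating_conic_def numeral_eq_enat)
qed

lemma sextactic: "sextactic_point F p"
  using p_in_V_fermat not_inflection hyperosculating_osc by (auto simp: sextactic_point_def)

text \<open>The conic is a multiple of \<open>osc\<close>, and the scalar is nonzero because a conic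
  is a nonzero form.\<close>

lemma V_hyperosculating:
  assumes "hyperosculating_conic F p Q"
  shows "V Q = V osc"
proof -
  have Q: "conic Q" "5 \<le> intersection_mult p Q F"
    using assms by (auto simp: hyperosculating_conic_def osculating_conic_def)
  then obtain s where "Q = const3 s * osc"
    using osc_unique by blast
  moreover have "s \<noteq> 0"
    using Q(1) calculation by (auto simp: conic_def)
  ultimately show ?thesis
    by (simp add: V_def eval3_simps)
qed

end

section \<open>The lines of the arrangements\<close>

lemma span_scale: "c \<noteq> 0 \<Longrightarrow> vec.span {c *s v} = vec.span {v}" for v :: "complex^3"
proof (rule vec.span_eq[THEN iffD2], intro conjI)
  assume "c \<noteq> 0"
  then have "v = (1 / c) *s (c *s v)"
    by (simp add: vector_smult_assoc)
  then have "v \<in> vec.span {c *s v}"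
    unfolding vec.span_singleton by blast
  then show "{v} \<subseteq> vec.span {c *s v}"
    by simp
  show "{c *s v} \<subseteq> vec.span {v}"
    by (auto simp: vec.span_singleton)
qed

lemma span_normalize:
  fixes u :: "complex^3"
  assumes "UNIV = {i, j, k}" "c \<noteq> 0" "u $ i = c * w $ i" "u $ j = c * w $ j" "u $ k = c * w $ k"
  shows "vec.span {u} = vec.span {w}"
proof -
  have "u $ a = (c *s w) $ a" for a
  proof -
    have "a = i \<or> a = j \<or> a = k"
      using assms(1) by blast
    then show ?thesis
      using assms(3-) by auto
  qed
  then have "u = c *s w"
    by (simp add: vec_eq_iff)
  then show ?thesis
    using span_scale[OF assms(2)] by simp
qed

lemma V_eq_spans:
  assumes "homogeneous3 n f"
  shows "V f = {vec.span {v} | v. v \<noteq> 0 \<and> eval3 f v = 0}"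
proof -
  have "q \<in> V f \<longleftrightarrow> (\<exists>v. q = vec.span {v} \<and> v \<noteq> 0 \<and> eval3 f v = 0)" for q
  proof
    assume "q \<in> V f"
    then obtain v where v: "q = vec.span {v}" "v \<noteq> 0"
      by (auto simp: V_def P2_def)
    with \<open>q \<in> V f\<close> show "\<exists>v. q = vec.span {v} \<and> v \<noteq> 0 \<and> eval3 f v = 0"
      using span_in_V_iff[OF assms, of v] by blast
  next
    assume "\<exists>v. q = vec.span {v} \<and> v \<noteq> 0 \<and> eval3 f v = 0"
    then show "q \<in> V f"
      using span_in_V_iff[OF assms] by blast
  qed
  then show ?thesis
    by blast
qed

text \<open>Together the two products run through \<open>x_k^d + 2 x_j^d\<close> for all six ordered
  pairs of distinct indices, so both arrangements can be treated alike.\<close>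

lemma arrangement_factor:
  assumes "vec.span {u} \<in> V (arrangement_M d) \<or> vec.span {u} \<in> V (arrangement_N d)"
  shows "\<exists>j k. j \<noteq> k \<and> (u $ k) ^ d + 2 * (u $ j) ^ d = 0"
proof -
  have "u \<in> vec.span {u}"
    by (simp add: vec.span_base)
  with assms have "eval3 (arrangement_M d) u = 0 \<or> eval3 (arrangement_N d) u = 0"
    by (auto simp: V_def)
  moreover have "(1::3) \<noteq> 2" "(2::3) \<noteq> 3" "(1::3) \<noteq> 3"
    by simp_all
  ultimately show ?thesis
    unfolding arrangement_M_def arrangement_N_def eval3_simps eval3_numeral mult_eq_0_iff
    by metis
qed

lemma third_index:
  fixes j k :: 3
  assumes "j \<noteq> k"
  obtains i where "UNIV = {i, j, k}" "i \<noteq> j" "i \<noteq> k"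
proof -
  have "card {j, k} \<noteq> CARD(3)"
    using assms by simp
  then have "{j, k} \<noteq> UNIV"
    by metis
  then obtain i where i: "i \<notin> {j, k}"
    by blast
  then have "card {i, j, k} = CARD(3)"
    using assms by simp
  then have "{i, j, k} = UNIV"
    by (intro card_subset_eq) simp_all
  with i show thesis
    using that[of i] by simp
qed

text \<open>
  On an affine chart of the line, two distinct points share the same equation \<open>x\<^sub>j = \<beta> x\<^sub>k\<close> because
  there are only finitely many such equations.
\<close>

lemma arrangement_line:
  assumes d: "d > 0"
    and line: "projective_line L"
    and sub: "L \<subseteq> V (arrangement_M d) \<or> L \<subseteq> V (arrangement_N d)"
  obtains i j k \<beta> where "UNIV = {i, j, k :: 3}" "i \<noteq> j" "i \<noteq> k" "j \<noteq> k" "\<beta> ^ d = - 1 / 2"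
    "L = {vec.span {v} | v. v \<noteq> 0 \<and> v $ j = \<beta> * v $ k}"
proof -
  obtain l where l: "homogeneous3 1 l" "l \<noteq> 0" "L = V l"
    using line by (auto simp: projective_line_def)
  obtain a b c where abc: "l = const3 a * X + const3 b * Y + const3 c * Z"
    using linear_form_eq[OF l(1) UNIV_3] by auto
  \<comment> \<open>Coefficients indexed by coordinate, so that the nonzero one may sit at any index
    \<open>i0\<close>.\<close>
  define m where "m = (\<lambda>x::3. if x = 1 then a else if x = 2 then b else c)"
  have m_123: "m 1 = a" "m 2 = b" "m 3 = c"
    by (simp_all add: m_def)
  have eval_l: "eval3 l v = (\<Sum>x\<in>UNIV. m x * v $ x)" for v
    by (simp add: abc sum_3 m_123 eval3_simps)
  have "\<exists>x. m x \<noteq> 0"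
  proof (rule ccontr)
    assume "\<nexists>x. m x \<noteq> 0"
    then have "a = 0" "b = 0" "c = 0"
      using m_123 by simp_all
    then show False
      using l(2) by (simp add: abc)
  qed
  then obtain i0 where i0: "m i0 \<noteq> 0"
    by blast
  obtain j0 where j0: "i0 \<noteq> j0"
    by (metis zero_neq_one)
  obtain k0 where "UNIV = {k0, i0, j0}" "k0 \<noteq> i0" "k0 \<noteq> j0"
    using third_index[OF j0] .
  with j0 have UNIV0: "UNIV = {i0, j0, k0}" "i0 \<noteq> j0" "i0 \<noteq> k0" "j0 \<noteq> k0"
    by (simp_all add: insert_commute)
  have sum0: "(\<Sum>x\<in>UNIV. h x) = h i0 + h j0 + h k0" for h :: "3 \<Rightarrow> complex"
    using UNIV0(2-) by (simp add: UNIV0(1) add.assoc)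
  \<comment> \<open>The points of the line in the chart \<open>x_j0 = 1\<close>, with parameter
    \<open>x_k0 = t\<close>; the equation of the line is solved for \<open>x_i0\<close>.\<close>
  define w :: "complex \<Rightarrow> complex^3" where
    "w t = (\<chi> x. if x = i0 then - (m j0 + t * m k0) / m i0 else if x = j0 then 1 else t)" for t
  have w: "w t $ i0 = - (m j0 + t * m k0) / m i0" "w t $ j0 = 1" "w t $ k0 = t" for t
    using UNIV0 by (simp_all add: w_def)
  define S where "S = {z :: complex. z ^ d = - 1 / 2}"
  have "card S = d"
    using card_nth_roots[of "- 1 / 2" d] d by (simp add: S_def)
  then have S: "finite S" "S \<noteq> {}"
    using d card_gt_0_iff[of S] by simp_all
  have "\<exists>s\<in>UNIV \<times> UNIV \<times> S. fst s \<noteq> fst (snd s) \<and> w t $ fst s = snd (snd s) * w t $ fst (snd s)" for t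
  proof -
    have "w t \<noteq> 0"
      using w(2)[of t] by auto
    moreover have "eval3 l (w t) = 0"
      using i0 by (simp add: eval_l sum0 w field_simps)
    ultimately have "vec.span {w t} \<in> L"
      unfolding l(3) using span_in_V_iff[OF l(1)] by blast
    then obtain j k where jk: "j \<noteq> k" "(w t $ k) ^ d + 2 * (w t $ j) ^ d = 0"
      using arrangement_factor[of "w t" d] sub by blast
    show ?thesis
    proof (cases "w t $ k = 0")
      case True
      \<comment> \<open>Both coordinates vanish, so \<open>x_j = z x_k\<close> holds for every root
        \<open>z\<close>, and any element of the nonempty \<open>S\<close> serves.\<close>
      then have "w t $ j = 0"
        using jk(2) d by (simp add: power_0_left)
      then show ?thesis
        using True jk(1) S(2) by force
    next
      case False
      have "(w t $ j / w t $ k) \<in> S"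
        using jk(2) False by (simp add: S_def power_divide field_simps eq_neg_iff_add_eq_0 add.commute)
      then show ?thesis
        using False jk(1) by (intro bexI[of _ "(j, k, w t $ j / w t $ k)"]) auto
    qed
  qed
  then obtain s where s: "\<And>t. s t \<in> UNIV \<times> UNIV \<times> S" "\<And>t. fst (s t) \<noteq> fst (snd (s t))"
      "\<And>t. w t $ fst (s t) = snd (snd (s t)) * w t $ fst (snd (s t))"
    by metis
  have "range s \<subseteq> UNIV \<times> UNIV \<times> S"
    using s(1) by blast
  then have "finite (range s)"
    by (rule finite_subset) (simp add: S(1))
  \<comment> \<open>Infinitely many parameters \<open>t\<close> share finitely many triples, so some
    equation holds at two distinct points.\<close>
  then obtain t0 where t0: "infinite {t \<in> UNIV. s t = s t0}"
    using pigeonhole_infinite[of "UNIV :: complex set" s] infinite_UNIV_char_0 by blast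
  then have "infinite ({t \<in> UNIV. s t = s t0} - {t0})"
    by simp
  then have "{t \<in> UNIV. s t = s t0} - {t0} \<noteq> {}"
    by (rule infinite_imp_nonempty)
  then obtain t1 where t1: "t1 \<noteq> t0" "s t1 = s t0"
    by blast
  obtain j k \<beta> where jk: "s t0 = (j, k, \<beta>)"
    by (cases "s t0") auto
  have jk_neq: "j \<noteq> k" and \<beta>: "\<beta> ^ d = - 1 / 2"
    using s(1)[of t0] s(2)[of t0] by (auto simp: jk S_def)
  have w_jk: "w t0 $ j = \<beta> * w t0 $ k" "w t1 $ j = \<beta> * w t1 $ k"
    using s(3)[of t0] s(3)[of t1] t1(2) by (simp_all add: jk)
  \<comment> \<open>The coefficient vector of \<open>x_j - \<beta> x_k\<close>, to be shown
    proportional to \<open>m\<close>; the index \<open>i0\<close> fixes the factor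
    \<open>\<mu>\<close>.\<close>
  define \<delta> :: "3 \<Rightarrow> complex" where "\<delta> x = (if x = j then 1 else 0) - \<beta> * (if x = k then 1 else 0)" for x
  have \<delta>: "(\<Sum>x\<in>UNIV. \<delta> x * v $ x) = v $ j - \<beta> * v $ k" for v :: "complex^3"
  proof -
    have "\<delta> x * v $ x = (if x = j then v $ x else 0) - (if x = k then \<beta> * v $ x else 0)" for x
      by (simp add: \<delta>_def algebra_simps)
    then show ?thesis
      by (simp add: sum_subtractf)
  qed
  define \<mu> where "\<mu> = \<delta> i0 / m i0"
  have eqs: "- \<mu> * (m j0 + t * m k0) + \<delta> j0 + \<delta> k0 * t = 0" if "t = t0 \<or> t = t1" for t
  proof -
    have "\<delta> i0 * w t $ i0 = - \<mu> * (m j0 + t * m k0)"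
      using i0 by (simp add: w \<mu>_def field_simps)
    moreover have "\<delta> i0 * w t $ i0 + \<delta> j0 + \<delta> k0 * t = 0"
      using \<delta>[of "w t"] w_jk that by (auto simp: sum0 w(2,3))
    ultimately show ?thesis
      by simp
  qed
  \<comment> \<open>An affine function of \<open>t\<close> with two distinct zeros: the slope
    vanishes first, then the constant term.\<close>
  have "(t0 - t1) * (\<delta> k0 - \<mu> * m k0) = 0"
    using eqs[OF disjI1, OF refl] eqs[OF disjI2, OF refl] by algebra
  then have \<delta>_k0: "\<delta> k0 = \<mu> * m k0"
    using t1(1) by simp
  have \<delta>_j0: "\<delta> j0 = \<mu> * m j0"
    using eqs[OF disjI1, OF refl] \<delta>_k0 by algebra
  have \<delta>_i0: "\<delta> i0 = \<mu> * m i0"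
    using i0 by (simp add: \<mu>_def)
  have \<delta>_eq: "\<delta> x = \<mu> * m x" for x
  proof -
    have "x = i0 \<or> x = j0 \<or> x = k0"
      using UNIV0(1) by blast
    then show ?thesis
      using \<delta>_i0 \<delta>_j0 \<delta>_k0 by auto
  qed
  have "\<delta> j \<noteq> 0"
    using jk_neq by (simp add: \<delta>_def)
  then have "\<mu> \<noteq> 0"
    by (auto simp: \<delta>_eq)
  have "eval3 l v = 0 \<longleftrightarrow> v $ j = \<beta> * v $ k" for v
  proof -
    have "v $ j - \<beta> * v $ k = \<mu> * eval3 l v"
      by (simp add: eval_l sum_distrib_left \<delta>_eq mult.assoc flip: \<delta>)
    then show ?thesis
      using \<open>\<mu> \<noteq> 0\<close> by (metis eq_iff_diff_eq_0 mult_eq_0_iff)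
  qed
  then have L: "L = {vec.span {v} | v. v \<noteq> 0 \<and> v $ j = \<beta> * v $ k}"
    unfolding l(3) V_eq_spans[OF l(1)] by simp
  obtain i where "UNIV = {i, j, k}" "i \<noteq> j" "i \<noteq> k"
    using third_index[OF jk_neq] .
  then show thesis
    using that[of i j k \<beta>] jk_neq \<beta> L by simp
qed

text \<open>Eliminating \<open>b\<close> and \<open>c\<close> leaves \<open>a\<close> times the
  Vandermonde determinant of the three roots.\<close>

lemma quadratic_three_roots:
  fixes a b c :: "'a::idom"
  assumes "distinct [x, y, z]" "\<And>t. t \<in> {x, y, z} \<Longrightarrow> a * t\<^sup>2 + b * t + c = 0"
  shows "a = 0"
proof -
  have "a * x\<^sup>2 + b * x + c = 0" "a * y\<^sup>2 + b * y + c = 0" "a * z\<^sup>2 + b * z + c = 0"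
    using assms(2) by auto
  then have "(x - y) * (y - z) * (x - z) * a = 0"
    by algebra
  then show ?thesis
    using assms(1) by auto
qed

section \<open>Counting the points on a line and the common points of their conics\<close>

theorem theorem4p13:
  fixes d :: nat and L :: "(complex^3) set set"
  assumes "d \<ge> 3"
    and "projective_line L"
    and "L \<subseteq> V (arrangement_M d) \<or> L \<subseteq> V (arrangement_N d)"
  shows "card {p \<in> L. sextactic_point (fermat d) p} = d \<and>
    card {q \<in> P2. \<forall>p\<in>L. sextactic_point (fermat d) p \<longrightarrow>
      (\<forall>Q. hyperosculating_conic (fermat d) p Q \<longrightarrow> q \<in> V Q)} = 2"
proof -
  have "d > 0"
    using assms(1) by simp
  obtain i j k \<beta> where ijk: "UNIV = {i, j, k :: 3}" "i \<noteq> j" "i \<noteq> k" "j \<noteq> k"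
    and \<beta>: "\<beta> ^ d = - 1 / 2"
    and L: "L = {vec.span {v} | v. v \<noteq> 0 \<and> v $ j = \<beta> * v $ k}"
    using arrangement_line[OF \<open>d > 0\<close> assms(2,3)] .
  have spec_ijk: "a = i \<or> a = j \<or> a = k" for a
    using ijk(1) by blast
  define S where "S = {\<alpha> :: complex. \<alpha> ^ d = - 1 / 2}"
  have card_S: "card S = d"
    using card_nth_roots[of "- 1 / 2" d] assms(1) by (simp add: S_def)
  have sext: "fermat_sextactic d i j k \<alpha> \<beta>" if "\<alpha> \<in> S" for \<alpha>
    using that assms(1) ijk \<beta> by (simp add: fermat_sextactic_def S_def)
  define pt where "pt \<alpha> = fermat_sextactic.pt i j \<alpha> \<beta>" for \<alpha>
  define osc where "osc \<alpha> = fermat_sextactic.osc d i j k \<alpha> \<beta>" for \<alpha>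
  have pt_eq: "pt \<alpha> $ i = \<alpha>" "pt \<alpha> $ j = \<beta>" "pt \<alpha> $ k = 1" if "\<alpha> \<in> S" for \<alpha>
    using fermat_sextactic.pt_def[OF sext[OF that]] ijk by (simp_all add: pt_def)
  have points: "{p \<in> L. sextactic_point (fermat d) p} = (\<lambda>\<alpha>. vec.span {pt \<alpha>}) ` S"
  proof (intro equalityI subsetI)
    fix p assume "p \<in> (\<lambda>\<alpha>. vec.span {pt \<alpha>}) ` S"
    then obtain \<alpha> where \<alpha>: "\<alpha> \<in> S" "p = vec.span {pt \<alpha>}"
      by blast
    have "pt \<alpha> \<noteq> 0"
      using pt_eq(3)[OF \<alpha>(1)] by auto
    then have "p \<in> L"
      unfolding L \<alpha>(2) using pt_eq[OF \<alpha>(1)] by auto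
    then show "p \<in> {p \<in> L. sextactic_point (fermat d) p}"
      using fermat_sextactic.sextactic[OF sext[OF \<alpha>(1)]] by (simp add: \<alpha>(2) pt_def)
  next
    fix p assume p: "p \<in> {p \<in> L. sextactic_point (fermat d) p}"
    then obtain v where v: "p = vec.span {v}" "v \<noteq> 0" "v $ j = \<beta> * v $ k"
      by (auto simp: L)
    have "eval3 (fermat d) v = 0"
      using p v span_in_V_iff[OF homogeneous3_fermat v(2)] by (simp add: sextactic_point_def)
    moreover have "eval3 (fermat d) v = (\<Sum>a\<in>UNIV. (v $ a) ^ d)"
      by (simp add: fermat_def eval3_simps sum_3)
    moreover have "(\<Sum>a\<in>UNIV. (v $ a) ^ d) = (v $ i) ^ d + (v $ j) ^ d + (v $ k) ^ d"
      using ijk(2-) by (simp add: ijk(1))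
    \<comment> \<open>On the line, \<open>x_j^d = - x_k^d / 2\<close>, so the Fermat equation leaves
      \<open>x_i^d + x_k^d / 2 = 0\<close>.\<close>
    ultimately have eq: "(v $ i) ^ d + (v $ k) ^ d / 2 = 0"
      by (simp add: v(3) power_mult_distrib \<beta> add.commute)
    have "v $ k \<noteq> 0"
    proof
      assume "v $ k = 0"
      moreover from this have "v $ j = 0" "v $ i = 0"
        using eq v(3) assms(1) by (simp_all add: power_0_left)
      ultimately have "v $ a = 0" for a
        using spec_ijk[of a] by auto
      then show False
        using v(2) by (simp add: vec_eq_iff)
    qed
    define \<alpha> where "\<alpha> = v $ i / v $ k"
    have "\<alpha> \<in> S"
      using eq \<open>v $ k \<noteq> 0\<close>
      by (simp add: S_def \<alpha>_def power_divide field_simps eq_neg_iff_add_eq_0 add.commute)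
    moreover have "vec.span {v} = vec.span {pt \<alpha>}"
      using \<open>v $ k \<noteq> 0\<close> pt_eq[OF calculation] v(3)
      by (intro span_normalize[OF ijk(1), of "v $ k"]) (simp_all add: \<alpha>_def)
    ultimately show "p \<in> (\<lambda>\<alpha>. vec.span {pt \<alpha>}) ` S"
      by (simp add: v(1))
  qed
  have "inj_on (\<lambda>\<alpha>. vec.span {pt \<alpha>}) S"
  proof (rule inj_onI)
    fix \<alpha> \<gamma> assume *: "\<alpha> \<in> S" "\<gamma> \<in> S" "vec.span {pt \<alpha>} = vec.span {pt \<gamma>}"
    then have "pt \<alpha> \<in> vec.span {pt \<gamma>}"
      using vec.span_base by blast
    then obtain c where "pt \<alpha> = c *s pt \<gamma>"
      by (auto simp: vec.span_singleton)
    then have "pt \<alpha> $ a = c * pt \<gamma> $ a" for a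
      by simp
    \<comment> \<open>Both vectors have coordinate 1 at \<open>k\<close>, hence
      \<open>c = 1\<close>.\<close>
    from this[of k] this[of i] show "\<alpha> = \<gamma>"
      using pt_eq[OF *(1)] pt_eq[OF *(2)] by simp
  qed
  then have "card {p \<in> L. sextactic_point (fermat d) p} = d"
    unfolding points by (simp add: card_image card_S)
  moreover have "card {q \<in> P2. \<forall>p\<in>L. sextactic_point (fermat d) p \<longrightarrow>
      (\<forall>Q. hyperosculating_conic (fermat d) p Q \<longrightarrow> q \<in> V Q)} = 2" (is "card ?T = 2")
  proof -
    \<comment> \<open>Three of the conics already force \<open>x_i = 0\<close> at a common point;
      \<open>d \<ge> 3\<close> provides them.\<close>
    obtain A where A: "A \<subseteq> S" "card A = 3"
      using obtain_subset_with_card_n[of 3 S] assms(1) card_S by auto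
    then obtain a1 a2 a3 where "A = {a1, a2, a3}" "a1 \<noteq> a2" "a1 \<noteq> a3" "a2 \<noteq> a3"
      by (auto simp: card_3_iff)
    with A have a: "a1 \<in> S" "a2 \<in> S" "a3 \<in> S" "distinct [1 / a1, 1 / a2, 1 / a3]"
      by auto
    \<comment> \<open>The constants \<open>cA\<close>, \<open>cB\<close>, \<open>cC\<close>,
      \<open>cE\<close> depend on \<open>d\<close> alone, so this one instance supplies them for
      every \<open>\<alpha>\<close>.\<close>
    interpret s1: fermat_sextactic d i j k a1 \<beta>
      using a(1) by (rule sext)
    \<comment> \<open>Every hyperosculating conic at the point of \<open>\<alpha>\<close> has the
      zero set of \<open>osc \<alpha>\<close>, which removes the quantifier over
      \<open>Q\<close>.\<close>
    have conics: "q \<in> ?T \<longleftrightarrow> q \<in> P2 \<and> (\<forall>\<alpha>\<in>S. q \<in> V (osc \<alpha>))" for q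
    proof -
      have "(\<forall>p\<in>L. sextactic_point (fermat d) p \<longrightarrow>
          (\<forall>Q. hyperosculating_conic (fermat d) p Q \<longrightarrow> q \<in> V Q))
        \<longleftrightarrow> (\<forall>p\<in>{p \<in> L. sextactic_point (fermat d) p}.
          \<forall>Q. hyperosculating_conic (fermat d) p Q \<longrightarrow> q \<in> V Q)"
        by blast
      also have "\<dots> \<longleftrightarrow> (\<forall>\<alpha>\<in>S. \<forall>Q. hyperosculating_conic (fermat d) (vec.span {pt \<alpha>}) Q \<longrightarrow> q \<in> V Q)"
        unfolding points by simp
      also have "\<dots> \<longleftrightarrow> (\<forall>\<alpha>\<in>S. q \<in> V (osc \<alpha>))"
        using fermat_sextactic.V_hyperosculating[OF sext] fermat_sextactic.hyperosculating_osc[OF sext]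
        unfolding pt_def osc_def by blast
      finally show ?thesis
        by simp
    qed
    have eval_osc: "eval3 (osc \<alpha>) u = s1.cA * (u $ i)\<^sup>2 * (1 / \<alpha>)\<^sup>2
        + u $ i * (s1.cB * (u $ j / \<beta>) + s1.cC * u $ k) * (1 / \<alpha>)
        + (s1.cA * (u $ j / \<beta>)\<^sup>2 + s1.cC * (u $ j / \<beta>) * u $ k + s1.cE * (u $ k)\<^sup>2)"
      if "\<alpha> \<in> S" for \<alpha> u
      unfolding osc_def by (rule fermat_sextactic.eval3_osc[OF sext[OF that]])
    have in_V_osc: "vec.span {u} \<in> V (osc \<alpha>) \<longleftrightarrow> eval3 (osc \<alpha>) u = 0" if "\<alpha> \<in> S" "u \<noteq> 0" for \<alpha> u
      using span_in_V_iff[of 2 "osc \<alpha>" u] fermat_sextactic.conic_osc[OF sext[OF that(1)]] that(2)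
      by (simp add: osc_def conic_def)
    \<comment> \<open>Points with \<open>x_i = 0\<close> in the chart \<open>x_k = 1\<close>; the
      factor \<open>\<beta>\<close> makes \<open>y\<close> the rescaled coordinate
      \<open>x_j / \<beta>\<close>.\<close>
    define e :: "complex \<Rightarrow> complex^3" where
      "e y = (\<chi> a. if a = i then 0 else if a = j then \<beta> * y else 1)" for y
    have e: "e y $ i = 0" "e y $ j = \<beta> * y" "e y $ k = 1" "e y \<noteq> 0" for y
    proof -
      show "e y $ i = 0" "e y $ j = \<beta> * y" and *: "e y $ k = 1"
        using ijk by (simp_all add: e_def)
      show "e y \<noteq> 0"
        using * by auto
    qed
    define R where "R = {y. s1.cA * y\<^sup>2 + s1.cC * y + s1.cE = 0}"
    have T_eq: "?T = (\<lambda>y. vec.span {e y}) ` R"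
    proof (intro equalityI subsetI)
      fix q assume "q \<in> (\<lambda>y. vec.span {e y}) ` R"
      then obtain y where y: "y \<in> R" "q = vec.span {e y}"
        by blast
      have "q \<in> V (osc \<alpha>)" if "\<alpha> \<in> S" for \<alpha>
        unfolding y(2) in_V_osc[OF that e(4)] eval_osc[OF that]
        using y(1) s1.\<beta>_neq_0 by (simp add: e R_def)
      moreover have "q \<in> P2"
        unfolding y(2) by (rule span_in_P2[OF e(4)])
      ultimately show "q \<in> ?T"
        by (intro conics[THEN iffD2] conjI ballI)
    next
      fix q assume "q \<in> ?T"
      then have q: "q \<in> P2" "\<And>\<alpha>. \<alpha> \<in> S \<Longrightarrow> q \<in> V (osc \<alpha>)"
        using conics[THEN iffD1, of q] by blast+
      obtain u where u: "q = vec.span {u}" "u \<noteq> 0"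
        using q(1) by (auto simp: P2_def)
      have zero: "eval3 (osc \<alpha>) u = 0" if "\<alpha> \<in> S" for \<alpha>
        using q(2)[OF that] in_V_osc[OF that u(2)] by (simp add: u(1))
      have "s1.cA * (u $ i)\<^sup>2 = 0"
      proof (rule quadratic_three_roots[OF a(4)])
        fix t assume "t \<in> {1 / a1, 1 / a2, 1 / a3}"
        then obtain \<alpha> where \<alpha>: "\<alpha> \<in> S" "t = 1 / \<alpha>"
          using a(1-3) by blast
        show "s1.cA * (u $ i)\<^sup>2 * t\<^sup>2 + u $ i * (s1.cB * (u $ j / \<beta>) + s1.cC * u $ k) * t
            + (s1.cA * (u $ j / \<beta>)\<^sup>2 + s1.cC * (u $ j / \<beta>) * u $ k + s1.cE * (u $ k)\<^sup>2) = 0"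
          unfolding \<alpha>(2) eval_osc[OF \<alpha>(1), symmetric] by (rule zero[OF \<alpha>(1)])
      qed
      then have ui: "u $ i = 0"
        using s1.cA_neq_0 by simp
      have eq: "s1.cA * (u $ j / \<beta>)\<^sup>2 + s1.cC * (u $ j / \<beta>) * u $ k + s1.cE * (u $ k)\<^sup>2 = 0"
        using zero[OF a(1)] by (simp add: eval_osc[OF a(1)] ui)
      \<comment> \<open>With \<open>x_i = x_k = 0\<close> the equation leaves
        \<open>cA (x_j / \<beta>)^2 = 0\<close>, and all coordinates would vanish.\<close>
      have uk: "u $ k \<noteq> 0"
      proof
        assume "u $ k = 0"
        moreover from this have "u $ j = 0"
          using eq s1.cA_neq_0 s1.\<beta>_neq_0 by simp
        ultimately have "u $ a = 0" for a
          using spec_ijk[of a] ui by auto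
        then show False
          using u(2) by (simp add: vec_eq_iff)
      qed
      define y where "y = u $ j / \<beta> / u $ k"
      have uj: "u $ j / \<beta> = y * u $ k"
        using uk by (simp add: y_def)
      have "(s1.cA * y\<^sup>2 + s1.cC * y + s1.cE) * (u $ k)\<^sup>2 = 0"
        using eq unfolding uj by (simp add: algebra_simps power2_eq_square)
      then have "y \<in> R"
        using uk by (simp add: R_def)
      moreover have "vec.span {u} = vec.span {e y}"
        using uk ui uj s1.\<beta>_neq_0
        by (intro span_normalize[OF ijk(1), of "u $ k"]) (simp_all add: e field_simps)
      ultimately show "q \<in> (\<lambda>y. vec.span {e y}) ` R"
        by (simp add: u(1))
    qed
    have inj: "inj_on (\<lambda>y. vec.span {e y}) R"
    proof (rule inj_onI)
      fix y z assume "vec.span {e y} = vec.span {e z}"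
      then have "e y \<in> vec.span {e z}"
        using vec.span_base by blast
      then obtain c where "e y = c *s e z"
        by (auto simp: vec.span_singleton)
      then have "e y $ a = c * e z $ a" for a
        by simp
      from this[of k] this[of j] show "y = z"
        using s1.\<beta>_neq_0 by (simp add: e)
    qed
    define r where "r = csqrt (s1.cC\<^sup>2 - 4 * s1.cA * s1.cE)"
    have r: "r\<^sup>2 = s1.cC\<^sup>2 - 4 * s1.cA * s1.cE"
      by (simp add: r_def)
    have "r \<noteq> 0"
      using r s1.discriminant_neq_0 by auto
    define y1 y2 where "y1 = (- s1.cC + r) / (2 * s1.cA)" "y2 = (- s1.cC - r) / (2 * s1.cA)"
    have y12: "2 * s1.cA * y1 = - s1.cC + r" "2 * s1.cA * y2 = - s1.cC - r"
      using s1.cA_neq_0 by (simp_all add: y1_y2_def)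
    have "y \<in> R \<longleftrightarrow> y = y1 \<or> y = y2" for y
    proof -
      \<comment> \<open>Multiplying by \<open>4 cA\<close> completes the square, and the
        factorization follows from \<open>r^2\<close> being the discriminant.\<close>
      have "4 * s1.cA * (s1.cA * y\<^sup>2 + s1.cC * y + s1.cE)
          = (2 * s1.cA * y - 2 * s1.cA * y1) * (2 * s1.cA * y - 2 * s1.cA * y2)"
        unfolding y12 using r by algebra
      also have "\<dots> = (2 * s1.cA)\<^sup>2 * ((y - y1) * (y - y2))"
        by (simp add: algebra_simps power2_eq_square)
      finally have eq: "4 * s1.cA * (s1.cA * y\<^sup>2 + s1.cC * y + s1.cE)
          = (2 * s1.cA)\<^sup>2 * ((y - y1) * (y - y2))" .
      have "y \<in> R \<longleftrightarrow> 4 * s1.cA * (s1.cA * y\<^sup>2 + s1.cC * y + s1.cE) = 0"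
        using s1.cA_neq_0 by (simp add: R_def)
      then show ?thesis
        unfolding eq using s1.cA_neq_0 by simp
    qed
    then have "R = {y1, y2}"
      by blast
    moreover have "y1 \<noteq> y2"
      using y12 \<open>r \<noteq> 0\<close> by auto
    ultimately have "card R = 2"
      by simp
    then show ?thesis
      unfolding T_eq by (simp add: card_image[OF inj])
  qed
  ultimately show ?thesis ..
qed

end
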